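(* Let $\mathbf K$ be as in the context and let $\downarrow$ be an almost-stable independence relation in $\mathbf K$. Then for all cardinals $\mu\le\lambda$ in $[\operatorname{LS}(\mathbf K),\infty)$ and every cardinal $\kappa$, \[ NT(\mu,\lambda,\kappa)\le\lambda^{(2^{\kappa_2(\downarrow)})}+\kappa^-. \]
   Context: $\mathbf{K}$ is an abstract elementary class (AEC) with strong substructure relation $\le_{\mathbf K}$ and Löwenheim–Skolem–Tarski number $\operatorname{LS}(\mathbf K)$, with joint embedding, amalgamation and no maximal models; we work in a monster model $\mathfrak C$. Galois-types $\mathbf{tp}(\mathbf b/A)$ are orbits of $\mathbf b$ under automorphisms of $\mathfrak C$ fixing $A$ pointwise; $\mathbf S^\alpha(M)$ is the set of Galois-types of length $\alpha$ over $M$, $\mathbf S^{<\infty}(M)=\bigcup_\alpha\mathbf S^\alpha(M)$. $\mathbf K_\lambda$ is the class of models of size $\lambda$. A set of Galois-types is consistent if a single $a\in\mathfrak C$ realizes all of them, otherwise inconsistent. An independence relation is a relation $A\downarrow_M B$ ($M\le_{\mathbf K}\mathfrak C$, $A,B\subseteq\mathfrak C$) satisfying: invariance under automorphisms of $\mathfrak C$; monotonicity; normality ($A\downarrow_MB$ iff $A\cup M\downarrow_MB\cup M$); base monotonicity (if $A\downarrow_MB$, $M\le_{\mathbf K}N$, $|N|\subseteq B$ then $A\downarrow_NB$); existence (every $p\in\mathbf S^{<\infty}(M)$ has, for each $N\ge_{\mathbf K}M$, an extension in $\mathbf S^{<\infty}(N)$ not forking over $M$); transitivity (if $M\le_{\mathbf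 K}N$, $A\downarrow_MN$, $A\downarrow_NB$ then $A\downarrow_MB$). "$\mathbf{tp}(\bar a/B)$ does not fork over $M$" means $\mathrm{ran}(\bar a)\downarrow_MB$. $\kappa_\alpha(\downarrow)$ is the least cardinal $\lambda$ (or $\infty$) such that every $p\in\mathbf S^\alpha(M)$ does not fork over some $M_0\le_{\mathbf K}M$ with $\|M_0\|\le\lambda$. $A$ does not explicitly split from $B$ over $M$, written $A\downarrow^{nes}_MB$, if for all $B_1,B_2\subseteq B$ with $\mathbf{tp}(B_1/M)=\mathbf{tp}(B_2/M)$ we have $\mathbf{tp}(AB_1/M)=\mathbf{tp}(AB_2/M)$. An almost-stable independence relation is an independence relation satisfying symmetry ($A\downarrow_MB$ iff $B\downarrow_MA$), local character ($\kappa_\alpha(\downarrow)<\infty$ for every cardinal $\alpha$), and $\downarrow\subseteq\downarrow^{nes}$ (i.e. $A\downarrow_MB$ implies $A\downarrow^{nes}_MB$). For $M\in\mathbf K$, $\mu\le\|M\|$: $\mathbf S(M,\le\mu)=\{\mathbf{tp}(a/N):a\in\mathfrak C,\ N\le_{\mathbf K}M,\ \|N\|\le\mu\}$; $NT(\mu,\lambda,\kappa)$ is the supremum of $|\Gamma|$ over all $\Gamma$ for which there is $M\in\mathbf K_\lambda$ with $\Gamma\subseteq\mathbf S(M,\le\mu)$ and every $\Delta\subseteq\Gamma$ with $|\Delta|\ge\kappa$ inconsistent. For a cardinal $\kappa$, $\kappa^-=\theta$ if $\kappa=\theta^+$ and $\kappa^-=\kappa$ otherwise.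
   Formalization: κ_2(↓) is taken as the least such cardinal in [LS(K),∞); this changes nothing if all models have size ≥ LS(K), but otherwise the bound fails, e.g. for LS(K) many independent unary predicates with A↓_M B iff A∩B⊆M. The symbol ∞ is rendered by a cardinal bounding the small subsets of the monster. *)

theory Defs
  imports Complex_Main "HOL-Library.FuncSet"
begin

unbundle cardinal_syntax

section \<open>Cardinals\<close>

definition least_card :: "('b rel \<Rightarrow> bool) \<Rightarrow> 'b rel" where
  "least_card P = (SOME r. Card_order r \<and> P r \<and> (\<forall>r'. Card_order r' \<and> P r' \<longrightarrow> r \<le>o r'))"

lemma least_card:
  assumes "Card_order r" and "P r"
  shows "Card_order (least_card P)" and "P (least_card P)" and "least_card P \<le>o r"
proof -
  have "\<exists>s\<in>{s. Card_order s \<and> P s}. \<forall>s'\<in>{s. Card_order s \<and> P s}. s \<le>o s'"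
    by (rule exists_minim_Card_order) (use assms in auto)
  then have "\<exists>s. Card_order s \<and> P s \<and> (\<forall>s'. Card_order s' \<and> P s' \<longrightarrow> s \<le>o s')"
    by auto
  from someI_ex[OF this]
  show "Card_order (least_card P)" and "P (least_card P)" and "least_card P \<le>o r"
    using assms unfolding least_card_def by auto
qed

text \<open>The supremum of the cardinalities of the members of a family. It exists among the cardinals
  on the type of the elements, because that type itself bounds the family.\<close>

definition card_Sup :: "'b set set \<Rightarrow> 'b rel" where
  "card_Sup F = least_card (\<lambda>r. \<forall>X\<in>F. |X| \<le>o r)"

text \<open>The operation \<open>\<kappa>\<^sup>-\<close>. A cardinal \<open>\<theta>\<close> with \<open>\<theta>\<^sup>+ = \<kappa>\<close> always has a representative on the
  type of \<open>\<kappa>\<close>; finite cardinals are included.\<close>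

definition card_pred :: "'b rel \<Rightarrow> 'b rel" where
  "card_pred r =
     (if \<exists>t::'b rel. Card_order t \<and> r =o cardSuc t
      then (SOME t. Card_order t \<and> r =o cardSuc t) else r)"


section \<open>Structures\<close>

record ('a, 'f, 'r) struct =
  carrier :: "'a set"
  funs :: "'f \<Rightarrow> 'a list \<Rightarrow> 'a"
  rels :: "'r \<Rightarrow> 'a list set"

text \<open>A vocabulary is a pair of partial arity functions, their domains being the sets of function
  and of relation symbols.\<close>

record ('a, 'f, 'r) aec =
  fun_ar :: "'f \<Rightarrow> nat option"
  rel_ar :: "'r \<Rightarrow> nat option"
  models :: "('a, 'f, 'r) struct set"
  le :: "('a, 'f, 'r) struct \<Rightarrow> ('a, 'f, 'r) struct \<Rightarrow> bool"

definition tuples :: "'a set \<Rightarrow> nat \<Rightarrow> 'a list set" where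
  "tuples A n = {xs. length xs = n \<and> set xs \<subseteq> A}"

text \<open>Interpretations have default values outside the vocabulary and outside the universe, so that
  equality of structures is the mathematical one.\<close>

definition is_struct :: "('a, 'f, 'r) aec \<Rightarrow> ('a, 'f, 'r) struct \<Rightarrow> bool" where
  "is_struct K M \<longleftrightarrow>
     carrier M \<noteq> {} \<and>
     (\<forall>s n xs. fun_ar K s = Some n \<and> xs \<in> tuples (carrier M) n \<longrightarrow> funs M s xs \<in> carrier M) \<and>
     (\<forall>s xs. (\<nexists>n. fun_ar K s = Some n \<and> xs \<in> tuples (carrier M) n) \<longrightarrow> funs M s xs = undefined) \<and>
     (\<forall>s xs. xs \<in> rels M s \<longrightarrow> (\<exists>n. rel_ar K s = Some n \<and> xs \<in> tuples (carrier M) n))"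

definition substruct :: "('a, 'f, 'r) aec \<Rightarrow> ('a, 'f, 'r) struct \<Rightarrow> ('a, 'f, 'r) struct \<Rightarrow> bool" where
  "substruct K M N \<longleftrightarrow>
     carrier M \<subseteq> carrier N \<and>
     (\<forall>s n xs. fun_ar K s = Some n \<and> xs \<in> tuples (carrier M) n \<longrightarrow> funs M s xs = funs N s xs) \<and>
     (\<forall>s n xs. rel_ar K s = Some n \<and> xs \<in> tuples (carrier M) n \<longrightarrow>
        (xs \<in> rels M s \<longleftrightarrow> xs \<in> rels N s))"

definition isom ::
  "('a, 'f, 'r) aec \<Rightarrow> ('a \<Rightarrow> 'a) \<Rightarrow> ('a, 'f, 'r) struct \<Rightarrow> ('a, 'f, 'r) struct \<Rightarrow> bool" where
  "isom K f M N \<longleftrightarrow>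
     bij_betw f (carrier M) (carrier N) \<and>
     (\<forall>s n xs. fun_ar K s = Some n \<and> xs \<in> tuples (carrier M) n \<longrightarrow>
        f (funs M s xs) = funs N s (map f xs)) \<and>
     (\<forall>s n xs. rel_ar K s = Some n \<and> xs \<in> tuples (carrier M) n \<longrightarrow>
        (xs \<in> rels M s \<longleftrightarrow> map f xs \<in> rels N s))"

text \<open>Meaningful for chains only: the choice of \<open>M\<close> is then irrelevant.\<close>

definition chain_union :: "('a, 'f, 'r) struct set \<Rightarrow> ('a, 'f, 'r) struct" where
  "chain_union F =
     \<lparr> carrier = (\<Union>M\<in>F. carrier M),
       funs = (\<lambda>s xs. if \<exists>M\<in>F. set xs \<subseteq> carrier M
                      then funs (SOME M. M \<in> F \<and> set xs \<subseteq> carrier M) s xs else undefined),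
       rels = (\<lambda>s. \<Union>M\<in>F. rels M s) \<rparr>"


section \<open>Abstract elementary classes\<close>

definition wo_chain :: "('a, 'f, 'r) aec \<Rightarrow> ('a, 'f, 'r) struct set \<Rightarrow> bool" where
  "wo_chain K F \<longleftrightarrow>
     F \<noteq> {} \<and> F \<subseteq> models K \<and> (\<forall>G. G \<subseteq> F \<and> G \<noteq> {} \<longrightarrow> (\<exists>M\<in>G. \<forall>N\<in>G. le K M N))"

definition LST_bound :: "('a, 'f, 'r) aec \<Rightarrow> 'a rel \<Rightarrow> bool" where
  "LST_bound K r \<longleftrightarrow>
     natLeq \<le>o r \<and> |dom (fun_ar K) <+> dom (rel_ar K)| \<le>o r \<and>
     (\<forall>M\<in>models K. \<forall>A. A \<subseteq> carrier M \<longrightarrow>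
        (\<exists>M0. le K M0 M \<and> A \<subseteq> carrier M0 \<and> |carrier M0| \<le>o |A| +c r))"

definition LS :: "('a, 'f, 'r) aec \<Rightarrow> 'a rel" where
  "LS K = least_card (LST_bound K)"

definition is_aec :: "('a, 'f, 'r) aec \<Rightarrow> bool" where
  "is_aec K \<longleftrightarrow>
     (\<forall>M\<in>models K. is_struct K M) \<and>
     \<comment> \<open>partial order refining the substructure relation\<close>
     (\<forall>M N. le K M N \<longrightarrow> M \<in> models K \<and> N \<in> models K \<and> substruct K M N) \<and>
     (\<forall>M\<in>models K. le K M M) \<and>
     (\<forall>M N. le K M N \<and> le K N M \<longrightarrow> M = N) \<and>
     (\<forall>M N P. le K M N \<and> le K N P \<longrightarrow> le K M P) \<and>
     \<comment> \<open>closure under isomorphisms\<close>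
     (\<forall>M N f. M \<in> models K \<and> is_struct K N \<and> isom K f M N \<longrightarrow> N \<in> models K) \<and>
     (\<forall>M N M' N' f. le K M N \<and> is_struct K M' \<and> is_struct K N' \<and> isom K f M M' \<and> isom K f N N'
        \<longrightarrow> le K M' N') \<and>
     \<comment> \<open>coherence\<close>
     (\<forall>M0 M1 M2. le K M0 M2 \<and> le K M1 M2 \<and> substruct K M0 M1 \<longrightarrow> le K M0 M1) \<and>
     \<comment> \<open>Tarski--Vaught chain axioms\<close>
     (\<forall>F. wo_chain K F \<longrightarrow>
        chain_union F \<in> models K \<and> (\<forall>M\<in>F. le K M (chain_union F)) \<and>
        (\<forall>N. (\<forall>M\<in>F. le K M N) \<longrightarrow> le K (chain_union F) N)) \<and>
     \<comment> \<open>Loewenheim--Skolem--Tarski axiom\<close>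
     (\<exists>r. Card_order r \<and> LST_bound K r)"

definition K_embedding ::
  "('a, 'f, 'r) aec \<Rightarrow> ('a \<Rightarrow> 'a) \<Rightarrow> ('a, 'f, 'r) struct \<Rightarrow> ('a, 'f, 'r) struct \<Rightarrow> bool" where
  "K_embedding K f M N \<longleftrightarrow> (\<exists>M'. isom K f M M' \<and> le K M' N)"

definition small_models :: "('a, 'f, 'r) aec \<Rightarrow> 'a rel \<Rightarrow> ('a, 'f, 'r) struct set" where
  "small_models K kb = {M \<in> models K. |carrier M| <o kb}"

definition joint_embedding :: "('a, 'f, 'r) aec \<Rightarrow> 'a rel \<Rightarrow> bool" where
  "joint_embedding K kb \<longleftrightarrow>
     (\<forall>M1\<in>small_models K kb. \<forall>M2\<in>small_models K kb.
        \<exists>N\<in>small_models K kb. \<exists>f1 f2. K_embedding K f1 M1 N \<and> K_embedding K f2 M2 N)"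

definition amalgamation :: "('a, 'f, 'r) aec \<Rightarrow> 'a rel \<Rightarrow> bool" where
  "amalgamation K kb \<longleftrightarrow>
     (\<forall>M0. \<forall>M1\<in>small_models K kb. \<forall>M2\<in>small_models K kb. le K M0 M1 \<and> le K M0 M2 \<longrightarrow>
        (\<exists>N\<in>small_models K kb. \<exists>f1 f2. K_embedding K f1 M1 N \<and> K_embedding K f2 M2 N \<and>
           (\<forall>x\<in>carrier M0. f1 x = f2 x)))"

definition no_maximal_models :: "('a, 'f, 'r) aec \<Rightarrow> 'a rel \<Rightarrow> bool" where
  "no_maximal_models K kb \<longleftrightarrow>
     (\<forall>M\<in>small_models K kb. \<exists>N\<in>small_models K kb. le K M N \<and> M \<noteq> N)"


section \<open>The monster model and Galois types\<close>

text \<open>The cardinal \<open>kb\<close> plays the role of \<open>\<infinity>\<close>: sets and models are small if their size is below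
  \<open>kb\<close>, and the monster \<open>C\<close> is universal and strongly homogeneous for small models. Since a
  fixed type cannot hold models of all sizes, joint embedding, amalgamation and absence of maximal
  models concern small models.\<close>

definition is_monster :: "('a, 'f, 'r) aec \<Rightarrow> ('a, 'f, 'r) struct \<Rightarrow> 'a rel \<Rightarrow> bool" where
  "is_monster K C kb \<longleftrightarrow>
     C \<in> models K \<and> Card_order kb \<and> LS K <o kb \<and> kb \<le>o |carrier C| \<and>
     (\<forall>M\<in>small_models K kb. \<exists>f. K_embedding K f M C) \<and>
     (\<forall>M N f. M \<in> small_models K kb \<and> le K M C \<and> le K N C \<and> isom K f M N \<longrightarrow>
        (\<exists>g. isom K g C C \<and> (\<forall>x\<in>carrier M. g x = f x)))"

definition small_set :: "('a, 'f, 'r) struct \<Rightarrow> 'a rel \<Rightarrow> 'a set \<Rightarrow> bool" where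
  "small_set C kb A \<longleftrightarrow> A \<subseteq> carrier C \<and> |A| <o kb"

definition small_sub ::
  "('a, 'f, 'r) aec \<Rightarrow> ('a, 'f, 'r) struct \<Rightarrow> 'a rel \<Rightarrow> ('a, 'f, 'r) struct \<Rightarrow> bool" where
  "small_sub K C kb M \<longleftrightarrow> le K M C \<and> |carrier M| <o kb"

definition Aut_over :: "('a, 'f, 'r) aec \<Rightarrow> ('a, 'f, 'r) struct \<Rightarrow> 'a set \<Rightarrow> ('a \<Rightarrow> 'a) set" where
  "Aut_over K C A = {g. isom K g C C \<and> (\<forall>x\<in>A. g x = x)}"

text \<open>Sequences are functions on an index set \<open>I\<close>. A Galois type is the orbit together with its
  domain, since orbits over different sets may coincide.\<close>

type_synonym ('i, 'a) gtype = "'a set \<times> ('i \<Rightarrow> 'a) set"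

definition gtp ::
  "('a, 'f, 'r) aec \<Rightarrow> ('a, 'f, 'r) struct \<Rightarrow> 'i set \<Rightarrow> ('i \<Rightarrow> 'a) \<Rightarrow> 'a set \<Rightarrow> ('i, 'a) gtype" where
  "gtp K C I b A = (A, {restrict (g \<circ> b) I | g. g \<in> Aut_over K C A})"

definition gS ::
  "('a, 'f, 'r) aec \<Rightarrow> ('a, 'f, 'r) struct \<Rightarrow> 'i set \<Rightarrow> ('a, 'f, 'r) struct \<Rightarrow> ('i, 'a) gtype set"
  where "gS K C I M = {gtp K C I b (carrier M) | b. b \<in> I \<rightarrow> carrier C}"

definition extends :: "('i, 'a) gtype \<Rightarrow> ('i, 'a) gtype \<Rightarrow> bool" where
  "extends q p \<longleftrightarrow> fst p \<subseteq> fst q \<and> snd q \<subseteq> snd p"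

definition gtp1 ::
  "('a, 'f, 'r) aec \<Rightarrow> ('a, 'f, 'r) struct \<Rightarrow> 'a \<Rightarrow> 'a set \<Rightarrow> (unit, 'a) gtype" where
  "gtp1 K C a A = gtp K C UNIV (\<lambda>_. a) A"

definition consistent :: "('a, 'f, 'r) struct \<Rightarrow> (unit, 'a) gtype set \<Rightarrow> bool" where
  "consistent C D \<longleftrightarrow> (\<exists>a\<in>carrier C. \<forall>p\<in>D. (\<lambda>_. a) \<in> snd p)"


section \<open>Independence relations\<close>

type_synonym ('a, 'f, 'r) ind_rel = "'a set \<Rightarrow> ('a, 'f, 'r) struct \<Rightarrow> 'a set \<Rightarrow> bool"

definition does_not_fork ::
  "('a, 'f, 'r) ind_rel \<Rightarrow> 'i set \<Rightarrow> ('i, 'a) gtype \<Rightarrow> ('a, 'f, 'r) struct \<Rightarrow> bool" where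
  "does_not_fork ind I p M \<longleftrightarrow> (\<exists>b\<in>snd p. ind (b ` I) M (fst p))"

definition independence ::
  "('a, 'f, 'r) aec \<Rightarrow> ('a, 'f, 'r) struct \<Rightarrow> 'a rel \<Rightarrow> ('a, 'f, 'r) ind_rel \<Rightarrow> bool" where
  "independence K C kb ind \<longleftrightarrow>
     \<comment> \<open>invariance\<close>
     (\<forall>A M B g M'. small_set C kb A \<and> small_set C kb B \<and> small_sub K C kb M \<and> small_sub K C kb M' \<and>
        isom K g C C \<and> isom K g M M' \<and> ind A M B \<longrightarrow> ind (g ` A) M' (g ` B)) \<and>
     \<comment> \<open>monotonicity\<close>
     (\<forall>A M B A' B'. small_set C kb A \<and> small_set C kb B \<and> small_sub K C kb M \<and>
        A' \<subseteq> A \<and> B' \<subseteq> B \<and> ind A M B \<longrightarrow> ind A' M B') \<and>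
     \<comment> \<open>normality\<close>
     (\<forall>A M B. small_set C kb A \<and> small_set C kb B \<and> small_sub K C kb M \<longrightarrow>
        (ind A M B \<longleftrightarrow> ind (A \<union> carrier M) M (B \<union> carrier M))) \<and>
     \<comment> \<open>base monotonicity\<close>
     (\<forall>A M N B. small_set C kb A \<and> small_set C kb B \<and> small_sub K C kb M \<and> small_sub K C kb N \<and>
        ind A M B \<and> le K M N \<and> carrier N \<subseteq> B \<longrightarrow> ind A N B) \<and>
     \<comment> \<open>existence\<close>
     (\<forall>(I::'a set) M N p. |I| <o kb \<and> small_sub K C kb M \<and> small_sub K C kb N \<and> le K M N \<and>
        p \<in> gS K C I M \<longrightarrow> (\<exists>q\<in>gS K C I N. extends q p \<and> does_not_fork ind I q M)) \<and>
     \<comment> \<open>transitivity\<close>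
     (\<forall>A M N B. small_set C kb A \<and> small_set C kb B \<and> small_sub K C kb M \<and> small_sub K C kb N \<and>
        le K M N \<and> ind A M (carrier N) \<and> ind A N B \<longrightarrow> ind A M B)"

definition local_bound ::
  "('a, 'f, 'r) aec \<Rightarrow> ('a, 'f, 'r) struct \<Rightarrow> 'a rel \<Rightarrow> ('a, 'f, 'r) ind_rel \<Rightarrow> 'i rel \<Rightarrow> 'a rel \<Rightarrow> bool"
  where
  "local_bound K C kb ind \<alpha> r \<longleftrightarrow>
     (\<forall>M. small_sub K C kb M \<longrightarrow>
        (\<forall>p\<in>gS K C (Field \<alpha>) M.
           \<exists>M0. le K M0 M \<and> |carrier M0| \<le>o r \<and> does_not_fork ind (Field \<alpha>) p M0))"

text \<open>The least cardinal is taken in \<open>[LS(K), \<infinity>)\<close>. If, as usual, all models have size at least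
  \<open>LS(K)\<close>, the condition \<open>LS K \<le>o r\<close> is redundant, see \<open>kappa_eq\<close> below. If smaller models are
  allowed, the number of types over a model need not be controlled by cardinals below \<open>LS(K)\<close>: for
  \<open>\<chi>\<close> many independent unary predicates and substructures, with \<open>A\<close> independent from \<open>B\<close> over \<open>M\<close>
  iff \<open>A \<inter> B \<subseteq> M\<close>, types of pairs do not fork over finite submodels, but there are \<open>2\<^sup>\<chi>\<close> types
  over every model.\<close>

definition kappa ::
  "('a, 'f, 'r) aec \<Rightarrow> ('a, 'f, 'r) struct \<Rightarrow> 'a rel \<Rightarrow> ('a, 'f, 'r) ind_rel \<Rightarrow> 'i rel \<Rightarrow> 'a rel" where
  "kappa K C kb ind \<alpha> = least_card (\<lambda>r. LS K \<le>o r \<and> local_bound K C kb ind \<alpha> r)"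

text \<open>Equality of types of sets refers to enumerations \<open>b1\<close>, \<open>b2\<close> with a common index set; in
  \<open>A B1\<close> and \<open>A B2\<close> the set \<open>A\<close> is enumerated identically, by itself.\<close>

definition nes ::
  "('a, 'f, 'r) aec \<Rightarrow> ('a, 'f, 'r) struct \<Rightarrow> 'a set \<Rightarrow> ('a, 'f, 'r) struct \<Rightarrow> 'a set \<Rightarrow> bool" where
  "nes K C A M B \<longleftrightarrow>
     (\<forall>(I::'a set) b1 b2. b1 \<in> I \<rightarrow> B \<and> b2 \<in> I \<rightarrow> B \<and>
        gtp K C I b1 (carrier M) = gtp K C I b2 (carrier M) \<longrightarrow>
        gtp K C (A <+> I) (case_sum id b1) (carrier M) = gtp K C (A <+> I) (case_sum id b2) (carrier M))"

definition almost_stable ::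
  "('a, 'f, 'r) aec \<Rightarrow> ('a, 'f, 'r) struct \<Rightarrow> 'a rel \<Rightarrow> ('a, 'f, 'r) ind_rel \<Rightarrow> bool" where
  "almost_stable K C kb ind \<longleftrightarrow>
     independence K C kb ind \<and>
     (\<forall>A M B. small_set C kb A \<and> small_set C kb B \<and> small_sub K C kb M \<longrightarrow>
        (ind A M B \<longleftrightarrow> ind B M A)) \<and>
     (\<forall>\<alpha>::'a rel. Card_order \<alpha> \<and> \<alpha> <o kb \<longrightarrow> kappa K C kb ind \<alpha> <o kb) \<and>
     (\<forall>A M B. small_set C kb A \<and> small_set C kb B \<and> small_sub K C kb M \<and> ind A M B \<longrightarrow>
        nes K C A M B)"

lemma kappa_eq:
  fixes K :: "('a, 'f, 'r) aec" and \<alpha> :: "'i rel"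
  assumes aec: "is_aec K" and mon: "is_monster K C kb"
    and big: "\<And>M. M \<in> models K \<Longrightarrow> LS K \<le>o |carrier M|"
  shows "kappa K C kb ind \<alpha> = least_card (local_bound K C kb ind \<alpha>)"
proof -
  have st: "\<forall>M\<in>models K. is_struct K M"
    and sub: "\<forall>M N. le K M N \<longrightarrow> M \<in> models K \<and> N \<in> models K \<and> substruct K M N"
    and lst: "\<exists>r. Card_order r \<and> LST_bound K r"
    using aec[unfolded is_aec_def] by - (elim conjE, assumption)+
  have "LS K \<le>o r" if r: "local_bound K C kb ind \<alpha> r" for r
  proof -
    have C: "C \<in> models K" "LS K <o kb"
      using mon[unfolded is_monster_def] by - (elim conjE, assumption)+
    obtain r0 where "Card_order r0" "LST_bound K r0"
      using lst by blast
    then have LS: "Card_order (LS K)" "LST_bound K (LS K)"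
      unfolding LS_def by (auto intro: least_card)
    have "\<forall>A. A \<subseteq> carrier C \<longrightarrow>
        (\<exists>M0. le K M0 C \<and> A \<subseteq> carrier M0 \<and> |carrier M0| \<le>o |A| +c LS K)"
      using LS(2) C(1) unfolding LST_bound_def by blast
    then obtain M where M: "le K M C" "|carrier M| \<le>o |{}::'a set| +c LS K"
      by blast
    have "natLeq \<le>o LS K"
      using LS(2) by (simp add: LST_bound_def)
    then have inf: "cinfinite (LS K)"
      by (rule cinfinite_mono[OF _ natLeq_cinfinite])
    have "|{}::'a set| \<le>o LS K"
      using LS(1) by (simp add: card_of_empty1 card_order_on_well_order_on)
    then have "|{}::'a set| +c LS K \<le>o LS K"
      using csum_absorb2'[of "LS K" "|{}::'a set|"] LS(1) inf ordIso_iff_ordLeq by blast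
    then have "|carrier M| <o kb"
      using M(2) C(2) ordLeq_transitive ordLeq_ordLess_trans by blast
    then have small: "small_sub K C kb M"
      using M(1) by (simp add: small_sub_def)
    obtain c where "c \<in> carrier C"
      using st C(1) unfolding is_struct_def by blast
    then have "gtp K C (Field \<alpha>) (\<lambda>_. c) (carrier M) \<in> gS K C (Field \<alpha>) M"
      by (auto simp: gS_def)
    then obtain M0 where M0: "le K M0 M" "|carrier M0| \<le>o r"
      using r small unfolding local_bound_def by blast
    then have "LS K \<le>o |carrier M0|"
      using sub big by blast
    then show ?thesis
      using M0(2) ordLeq_transitive by blast
  qed
  then have "(\<lambda>r. LS K \<le>o r \<and> local_bound K C kb ind \<alpha> r) = local_bound K C kb ind \<alpha>"
    by auto
  then show ?thesis
    unfolding kappa_def by simp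
qed


section \<open>The number of inconsistent types\<close>

definition S_le ::
  "('a, 'f, 'r) aec \<Rightarrow> ('a, 'f, 'r) struct \<Rightarrow> ('a, 'f, 'r) struct \<Rightarrow> 'm rel \<Rightarrow> (unit, 'a) gtype set"
  where
  "S_le K C M \<mu> =
     {gtp1 K C a (carrier N) | a N. a \<in> carrier C \<and> le K N M \<and> |carrier N| \<le>o \<mu>}"

text \<open>Every model of size \<open>\<lambda>\<close> below \<open>\<infinity>\<close> has an isomorphic copy below the monster, where its types
  live.\<close>

definition NT ::
  "('a, 'f, 'r) aec \<Rightarrow> ('a, 'f, 'r) struct \<Rightarrow> 'm rel \<Rightarrow> 'l rel \<Rightarrow> 'k rel \<Rightarrow> (unit, 'a) gtype rel" where
  "NT K C \<mu> lam \<kappa> =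
     card_Sup {\<Gamma>. \<exists>M. le K M C \<and> |carrier M| =o lam \<and> \<Gamma> \<subseteq> S_le K C M \<mu> \<and>
                  (\<forall>\<Delta>. \<Delta> \<subseteq> \<Gamma> \<and> \<kappa> \<le>o |\<Delta>| \<longrightarrow> \<not> consistent C \<Delta>)}"

end

theory Submission
  imports Defs
begin

text \<open>
  If \<open>a\<close> and \<open>a'\<close> have the same type over \<open>M\<close>, then a type over a submodel of \<open>M\<close> realized by \<open>a\<close>
  is also realized by \<open>a'\<close>. Hence \<open>\<Gamma>\<close> is covered by consistent subsets, one for each type over \<open>M\<close>,
  which have size less than \<open>\<kappa>\<close>, and it suffices to find at most \<open>\<lambda>^(2^\<chi>)\<close> types over \<open>M\<close>, where
  \<open>\<chi> = \<kappa>\<^sub>2\<close>.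

  Pairs \<open>a, a'\<close> are independent from \<open>M\<close> over some submodel of size \<open>\<chi>\<close>, and by symmetry \<open>M\<close> does not
  explicitly split from \<open>{a, a'}\<close> over it. So if the types of \<open>a\<close> and \<open>a'\<close> over \<open>M\<close> differ, then so do
  their restrictions to a submodel of size \<open>\<chi>\<close>.

  Let \<open>a\<close> be independent from \<open>M\<close> over a submodel enumerated by a sequence \<open>m\<close> of length \<open>\<chi>\<close>. For every
  sequence \<open>h\<close> of length \<open>\<chi>\<close> in \<open>M\<close>, the type of \<open>(m, h)\<close> determines that of \<open>(m, h, a)\<close>, as \<open>a\<close> does
  not explicitly split from \<open>M\<close>. This function, on a set of at most \<open>2^\<chi>\<close> types with at most \<open>2^\<chi>\<close>
  values, together with \<open>m\<close> determines the type of \<open>a\<close> over all submodels of size \<open>\<chi>\<close>, hence over \<open>M\<close>.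
\<close>

section \<open>Cardinalities\<close>

text \<open>Structures interpret symbols by sets of lists, so this bounds what is needed to code
  them. Lists are split by length, and nonempty ones into head and tail.\<close>

lemma card_of_lists_ordLeq:
  assumes "infinite X"
  shows "|lists X| \<le>o |X|"
proof -
  have len: "|{xs. length xs = n \<and> set xs \<subseteq> X}| \<le>o |X|" for n
  proof (induction n)
    case 0
    have "{xs. length xs = 0 \<and> set xs \<subseteq> X} = {[]}" by auto
    then show ?case
      using assms by (simp add: card_of_singl_ordLeq infinite_imp_nonempty)
  next
    case (Suc n)
    have "{xs. length xs = Suc n \<and> set xs \<subseteq> X}
        \<subseteq> (\<lambda>(x, xs). x # xs) ` (X \<times> {xs. length xs = n \<and> set xs \<subseteq> X})"
      by (auto simp: length_Suc_conv image_iff)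
    then have "|{xs. length xs = Suc n \<and> set xs \<subseteq> X}| \<le>o |X \<times> {xs. length xs = n \<and> set xs \<subseteq> X}|"
      by (rule surj_imp_ordLeq)
    also have "|X \<times> {xs. length xs = n \<and> set xs \<subseteq> X}| \<le>o |X|"
      using assms Suc by (intro card_of_Sigma_ordLeq_infinite) (auto simp: card_of_mono1)
    finally show ?case .
  qed
  have "lists X = (\<Union>n\<in>UNIV. {xs. length xs = n \<and> set xs \<subseteq> X})"
    by auto
  moreover have "|\<Union>n\<in>UNIV. {xs. length xs = n \<and> set xs \<subseteq> X}| \<le>o |X|"
    using assms len infinite_iff_card_of_nat by (intro card_of_UNION_ordLeq_infinite) blast+
  ultimately show ?thesis by simp
qed

lemma card_of_Pow_ordLeq:
  assumes "|A| \<le>o |B|"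
  shows "|Pow A| \<le>o |Pow B|"
proof -
  obtain f where "inj_on f A" "f ` A \<subseteq> B"
    using assms unfolding card_of_ordLeq[symmetric] by blast
  then show ?thesis
    by (intro card_of_ordLeqI[where f = "image f"]) (auto intro: inj_on_image_Pow)
qed

lemma Plus_eq_iff: "A <+> B = A' <+> B' \<longleftrightarrow> A = A' \<and> B = B'"
  by (auto simp: Plus_def)

section \<open>Structures\<close>

lemma map_in_tuples: "f ` A \<subseteq> B \<Longrightarrow> xs \<in> tuples A n \<Longrightarrow> map f xs \<in> tuples B n"
  by (auto simp: tuples_def)

lemma isom_id: "isom K id M M"
  by (simp add: isom_def)

lemma isom_comp:
  assumes "isom K f M N" and "isom K g N P"
  shows "isom K (g \<circ> f) M P"
proof -
  have "f ` carrier M \<subseteq> carrier N"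
    using assms(1) by (auto simp: isom_def bij_betw_def)
  note t = map_in_tuples[OF this]
  have "(g \<circ> f) (funs M s xs) = funs P s (map (g \<circ> f) xs)"
    if "fun_ar K s = Some n" "xs \<in> tuples (carrier M) n" for s n xs
  proof -
    have "g (funs N s (map f xs)) = funs P s (map g (map f xs))"
      using assms(2) that(1) t[OF that(2)] unfolding isom_def by blast
    moreover have "f (funs M s xs) = funs N s (map f xs)"
      using assms(1) that unfolding isom_def by blast
    ultimately show ?thesis by simp
  qed
  moreover have "xs \<in> rels M s \<longleftrightarrow> map (g \<circ> f) xs \<in> rels P s"
    if "rel_ar K s = Some n" "xs \<in> tuples (carrier M) n" for s n xs
  proof -
    have "map f xs \<in> rels N s \<longleftrightarrow> map g (map f xs) \<in> rels P s"
      using assms(2) that(1) t[OF that(2)] unfolding isom_def by blast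
    moreover have "xs \<in> rels M s \<longleftrightarrow> map f xs \<in> rels N s"
      using assms(1) that unfolding isom_def by blast
    ultimately show ?thesis by simp
  qed
  moreover have "bij_betw (g \<circ> f) (carrier M) (carrier P)"
    using assms by (auto simp: isom_def intro: bij_betw_trans)
  ultimately show ?thesis
    unfolding isom_def by blast
qed

text \<open>Closure of \<open>M\<close> under its functions, from \<open>is_struct K M\<close>,
  matters here: \<open>inv_into\<close> undoes \<open>f\<close> only on \<open>carrier M\<close>, so
  the value \<open>funs M s xs\<close> must lie there.\<close>

lemma isom_inv:
  assumes "is_struct K M" and "isom K f M N"
  shows "isom K (inv_into (carrier M) f) N M"
proof -
  let ?h = "inv_into (carrier M) f"
  have f: "bij_betw f (carrier M) (carrier N)"
    and fn: "\<And>s n xs. fun_ar K s = Some n \<Longrightarrow> xs \<in> tuples (carrier M) n \<Longrightarrow>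
        f (funs M s xs) = funs N s (map f xs)"
    and rl: "\<And>s n xs. rel_ar K s = Some n \<Longrightarrow> xs \<in> tuples (carrier M) n \<Longrightarrow>
        xs \<in> rels M s \<longleftrightarrow> map f xs \<in> rels N s"
    using assms(2) by (auto simp: isom_def)
  have cl: "\<And>s n xs. fun_ar K s = Some n \<Longrightarrow> xs \<in> tuples (carrier M) n \<Longrightarrow> funs M s xs \<in> carrier M"
    using assms(1) unfolding is_struct_def by blast
  have h: "bij_betw ?h (carrier N) (carrier M)"
    using f by (rule bij_betw_inv_into)
  have t: "map ?h ys \<in> tuples (carrier M) n" "map f (map ?h ys) = ys"
    if "ys \<in> tuples (carrier N) n" for ys n
  proof -
    show "map ?h ys \<in> tuples (carrier M) n"
      using h that by (auto simp: bij_betw_def intro!: map_in_tuples[of _ "carrier N"])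
    show "map f (map ?h ys) = ys"
      using that f by (auto simp: tuples_def o_def bij_betw_inv_into_right intro!: map_idI)
  qed
  have "?h (funs N s ys) = funs M s (map ?h ys)"
    if "fun_ar K s = Some n" "ys \<in> tuples (carrier N) n" for s n ys
    using fn[OF that(1) t(1)[OF that(2)]] t(2)[OF that(2)] cl[OF that(1) t(1)[OF that(2)]] f
    by (metis bij_betw_inv_into_left)
  moreover have "ys \<in> rels N s \<longleftrightarrow> map ?h ys \<in> rels M s"
    if "rel_ar K s = Some n" "ys \<in> tuples (carrier N) n" for s n ys
    using rl[OF that(1) t(1)[OF that(2)]] t(2)[OF that(2)] by simp
  ultimately show ?thesis
    using h by (auto simp: isom_def)
qed

text \<open>Serves the invariance axiom, which also asks for an isomorphism between the bases: an
  automorphism fixing the base pointwise provides one.\<close>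

lemma isom_fixing_substruct:
  assumes "is_struct K M" and "\<And>x. x \<in> carrier M \<Longrightarrow> g x = x"
  shows "isom K g M M"
proof -
  have "map g xs = xs" if "xs \<in> tuples (carrier M) n" for xs n
    using that assms(2) by (auto simp: tuples_def intro!: map_idI)
  moreover have "bij_betw g (carrier M) (carrier M)"
    using assms(2) bij_betw_cong[of "carrier M" g id] by simp
  moreover have "funs M s xs \<in> carrier M" if "fun_ar K s = Some n" "xs \<in> tuples (carrier M) n" for s n xs
    using that assms(1) unfolding is_struct_def by blast
  ultimately show ?thesis
    using assms(2) unfolding isom_def by metis
qed

lemma ex_isom_image:
  assumes "is_struct K M" and "inj_on e (carrier M)"
  obtains P where "is_struct K P" and "carrier P = e ` carrier M" and "isom K e M P"
proof -
  let ?h = "inv_into (carrier M) e"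
  \<comment> \<open>The interpretation is transported along \<open>e\<close>, with the defaults that
    \<open>is_struct\<close> prescribes outside the vocabulary and the universe.\<close>
  define P where "P = \<lparr>carrier = e ` carrier M,
    funs = (\<lambda>s ys. if \<exists>n. fun_ar K s = Some n \<and> ys \<in> tuples (e ` carrier M) n
                   then e (funs M s (map ?h ys)) else undefined),
    rels = (\<lambda>s. map e ` rels M s)\<rparr>"
  have cl: "\<And>s n xs. fun_ar K s = Some n \<Longrightarrow> xs \<in> tuples (carrier M) n \<Longrightarrow> funs M s xs \<in> carrier M"
    and ne: "carrier M \<noteq> {}"
    and rl: "\<And>s xs. xs \<in> rels M s \<Longrightarrow> \<exists>n. rel_ar K s = Some n \<and> xs \<in> tuples (carrier M) n"
    using assms(1) unfolding is_struct_def by blast+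
  have e: "map e xs \<in> tuples (e ` carrier M) n" "map ?h (map e xs) = xs"
    if "xs \<in> tuples (carrier M) n" for xs n
    using that assms(2) by (auto simp: tuples_def o_def intro!: map_idI)
  have h: "map ?h ys \<in> tuples (carrier M) n" if "ys \<in> tuples (e ` carrier M) n" for ys n
    using that by (auto simp: tuples_def inv_into_into)
  have P: "carrier P = e ` carrier M" "\<And>s. rels P s = map e ` rels M s"
    "\<And>s n ys. fun_ar K s = Some n \<Longrightarrow> ys \<in> tuples (e ` carrier M) n \<Longrightarrow> funs P s ys = e (funs M s (map ?h ys))"
    "\<And>s ys. \<nexists>n. fun_ar K s = Some n \<and> ys \<in> tuples (e ` carrier M) n \<Longrightarrow> funs P s ys = undefined"
    by (auto simp: P_def)
  have "is_struct K P"
    unfolding is_struct_def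
  proof (intro conjI allI impI)
    show "carrier P \<noteq> {}" using ne P(1) by simp
    show "funs P s xs \<in> carrier P" if "fun_ar K s = Some n \<and> xs \<in> tuples (carrier P) n" for s n xs
      using that P(1) P(3)[of s n xs] cl[of s n] h[of xs n] by auto
    show "funs P s xs = undefined" if "\<nexists>n. fun_ar K s = Some n \<and> xs \<in> tuples (carrier P) n" for s xs
      using that P(1) P(4) by simp
    show "\<exists>n. rel_ar K s = Some n \<and> xs \<in> tuples (carrier P) n" if "xs \<in> rels P s" for s xs
      using that P(1,2) rl e(1) by fastforce
  qed
  moreover have "isom K e M P"
    unfolding isom_def
  proof (intro conjI allI impI)
    show "bij_betw e (carrier M) (carrier P)"
      using assms(2) P(1) by (simp add: bij_betw_def)
    show "e (funs M s xs) = funs P s (map e xs)"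
      if "fun_ar K s = Some n \<and> xs \<in> tuples (carrier M) n" for s n xs
      using that P(3) e by metis
    show "xs \<in> rels M s \<longleftrightarrow> map e xs \<in> rels P s"
      if a: "rel_ar K s = Some n \<and> xs \<in> tuples (carrier M) n" for s n xs
    proof
      assume "map e xs \<in> rels P s"
      then obtain ys where ys: "ys \<in> rels M s" "map e xs = map e ys"
        using P(2) by auto
      then have "xs = ys"
        using rl e(2) a by metis
      with ys show "xs \<in> rels M s" by simp
    qed (use P(2) in auto)
  qed
  ultimately show ?thesis
    using P(1) that by blast
qed

text \<open>The summands are the universe, the graphs of the functions, with the value put in front
  of the arguments, and the relations. If the universe lies in an infinite \<open>X\<close> at least
  as large as the vocabulary, the code is a subset of a set of size \<open>|X|\<close>.\<close>

definition struct_code ::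
  "('a, 'f, 'r) aec \<Rightarrow> ('a, 'f, 'r) struct \<Rightarrow> ('a + 'f \<times> 'a list + 'r \<times> 'a list) set" where
  "struct_code K P = carrier P <+>
     {(s, funs P s xs # xs) | s xs. \<exists>n. fun_ar K s = Some n \<and> xs \<in> tuples (carrier P) n} <+>
     {(s, xs). xs \<in> rels P s}"

lemma struct_code_inject:
  assumes "is_struct K P" and "is_struct K Q" and "struct_code K P = struct_code K Q"
  shows "P = Q"
proof -
  have c: "carrier P = carrier Q"
    and f: "{(s, funs P s xs # xs) | s xs. \<exists>n. fun_ar K s = Some n \<and> xs \<in> tuples (carrier P) n}
      = {(s, funs Q s xs # xs) | s xs. \<exists>n. fun_ar K s = Some n \<and> xs \<in> tuples (carrier Q) n}"
    and r: "{(s, xs). xs \<in> rels P s} = {(s, xs). xs \<in> rels Q s}"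
    using assms(3) unfolding struct_code_def Plus_eq_iff by - (elim conjE, assumption)+
  have "funs P s xs = funs Q s xs" for s xs
  proof (cases "\<exists>n. fun_ar K s = Some n \<and> xs \<in> tuples (carrier P) n")
    case True
    then have "(s, funs P s xs # xs) \<in>
        {(s, funs P s xs # xs) | s xs. \<exists>n. fun_ar K s = Some n \<and> xs \<in> tuples (carrier P) n}"
      by blast
    then show ?thesis unfolding f by auto
  next
    \<comment> \<open>Where the code records nothing, both interpretations take the default value
      \<open>undefined\<close>.\<close>
    case False
    then have "\<nexists>n. fun_ar K s = Some n \<and> xs \<in> tuples (carrier Q) n"
      using c by simp
    with False show ?thesis
      using assms(1,2) unfolding is_struct_def by metis
  qed
  moreover have "rels P s = rels Q s" for s
    using r by auto
  ultimately show ?thesis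
    using c by (intro struct.equality ext) auto
qed

lemma struct_code_subset:
  assumes "is_struct K P" and "carrier P \<subseteq> X"
  shows "struct_code K P \<subseteq> X <+> (dom (fun_ar K) \<times> lists X) <+> (dom (rel_ar K) \<times> lists X)"
proof -
  have "funs P s xs # xs \<in> lists X"
    if "fun_ar K s = Some n" "xs \<in> tuples (carrier P) n" for s n xs
    using assms that unfolding is_struct_def by (auto simp: tuples_def)
  moreover have "xs \<in> lists X \<and> s \<in> dom (rel_ar K)" if "xs \<in> rels P s" for s xs
    using assms that unfolding is_struct_def tuples_def by fastforce
  ultimately show ?thesis
    using assms(2) unfolding struct_code_def by (fastforce simp: Plus_def)
qed

section \<open>Types of tuples in the monster model\<close>

locale monster =
  fixes K :: "('a, 'f, 'r) aec" and C :: "('a, 'f, 'r) struct" and kb :: "'a rel"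
  assumes aec: "is_aec K" and mon: "is_monster K C kb"
begin

section \<open>Consequences of the axioms and small models in the monster\<close>

lemma
  shows models_struct[rule_format]: "\<forall>M\<in>models K. is_struct K M"
    and le_models[rule_format]: "\<forall>M N. le K M N \<longrightarrow> M \<in> models K \<and> N \<in> models K \<and> substruct K M N"
    and le_refl[rule_format]: "\<forall>M\<in>models K. le K M M"
    and le_trans[unfolded imp_conjL, rule_format]:
      "\<forall>M N P. le K M N \<and> le K N P \<longrightarrow> le K M P"
    and ex_LST_bound: "\<exists>r. Card_order r \<and> LST_bound K r"
  using aec[unfolded is_aec_def] by - (elim conjE, assumption)+

lemma le_carrier: "le K M N \<Longrightarrow> carrier M \<subseteq> carrier N"
  using le_models unfolding substruct_def by blast

lemma C_model: "C \<in> models K"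
  using mon by (simp add: is_monster_def)

lemma LS_bound: "Card_order (LS K)" "LST_bound K (LS K)"
proof -
  obtain r where "Card_order r" "LST_bound K r"
    using ex_LST_bound by blast
  then show "Card_order (LS K)" "LST_bound K (LS K)"
    unfolding LS_def by (auto intro: least_card)
qed

lemma Cinfinite_LS: "Cinfinite (LS K)"
  using LS_bound cinfinite_mono[OF _ natLeq_cinfinite] by (auto simp: LST_bound_def)

lemma Cinfinite_kb: "Cinfinite kb"
proof -
  have "LS K <o kb" "Card_order kb"
    using mon by (auto simp: is_monster_def)
  then show ?thesis
    using cinfinite_mono Cinfinite_LS ordLess_imp_ordLeq by blast
qed

lemma finite_ordLess_kb: "finite A \<Longrightarrow> |A| <o kb"
  using Cinfinite_kb card_of_Card_order[of A]
  by (intro Cfinite_ordLess_Cinfinite) (auto simp: cfinite_def Field_card_of)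

text \<open>Loewenheim-Skolem gives a model of size at most \<open>|A| +c LS K\<close>, which meets
  both bounds: the one by \<open>|X|\<close> is needed to code the model inside \<open>X\<close>,
  the one by \<open>kb\<close> to apply homogeneity.\<close>

lemma ex_small_model:
  assumes "A \<subseteq> carrier C" and "|A| \<le>o |X|" and "LS K \<le>o |X|" and "|A| <o kb"
  obtains N where "le K N C" and "A \<subseteq> carrier N" and "|carrier N| \<le>o |X|" and "|carrier N| <o kb"
proof -
  obtain N where N: "le K N C" "A \<subseteq> carrier N" "|carrier N| \<le>o |A| +c LS K"
    using assms(1) LS_bound(2) C_model unfolding LST_bound_def by blast
  have "Cinfinite |X|"
    using assms(3) Cinfinite_LS cinfinite_mono card_of_Card_order by blast
  then have "|A| +c LS K \<le>o |X|"
    using assms LS_bound by (intro csum_cinfinite_bound) (auto simp: card_of_Card_order)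
  moreover have "|A| +c LS K <o kb"
  proof -
    have "|Field (LS K)| <o kb"
      using LS_bound(1) mon card_of_Field_ordIso ordIso_ordLess_trans
      unfolding is_monster_def by blast
    then show ?thesis
      using assms(4) Cinfinite_kb unfolding csum_def cinfinite_def
      by (intro card_of_Plus_ordLess_infinite_Field) (auto simp: Field_card_of)
  qed
  ultimately show ?thesis
    using N that ordLeq_transitive ordLeq_ordLess_trans by blast
qed

lemma homogeneity:
  assumes "le K M C" and "|carrier M| <o kb" and "le K N C" and "isom K f M N"
  shows "\<exists>g. isom K g C C \<and> (\<forall>x\<in>carrier M. g x = f x)"
proof -
  have "M \<in> small_models K kb"
    using assms le_models by (auto simp: small_models_def)
  then show ?thesis
    using assms mon unfolding is_monster_def by blast
qed

text \<open>Only the range has to be small. The index set will have size \<open>chi\<close>, which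
  is not compared with \<open>kb\<close>, whereas the ranges lie in a small model with at most one
  more point.\<close>

definition small_tuples :: "'j set \<Rightarrow> ('j \<Rightarrow> 'a) set" where
  "small_tuples J = {d \<in> J \<rightarrow> carrier C. |d ` J| <o kb}"

text \<open>Bounds the number of orbits from above: there are at most \<open>2^|X|\<close> codes,
  and tuples with equal codes are conjugate. Conjugate tuples may still have different
  codes.\<close>

definition tuple_code :: "'j set \<Rightarrow> 'a set \<Rightarrow> (('j \<Rightarrow> 'a) \<Rightarrow> 'a set) \<Rightarrow> bool" where
  "tuple_code J X code \<longleftrightarrow> (\<forall>d\<in>small_tuples J. code d \<subseteq> X) \<and>
     (\<forall>d\<in>small_tuples J. \<forall>d'\<in>small_tuples J. code d = code d' \<longrightarrow>
        (\<exists>g. isom K g C C \<and> (\<forall>j\<in>J. g (d j) = d' j)))"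

text \<open>A tuple is coded by the isomorphism type of a model of size \<open>|X|\<close> around it, transported
  into \<open>X\<close>; strong homogeneity of the monster turns equality of codes into conjugacy.\<close>

lemma ex_tuple_code:
  fixes X :: "'a set" and J :: "'j set"
  assumes X: "LS K \<le>o |X|" and J: "|J| \<le>o |X|"
  shows "\<exists>code. tuple_code J X code"
proof -
  have inf: "infinite X"
    using X Cinfinite_LS cinfinite_mono[OF X] by (simp add: cinfinite_def Field_card_of)
  \<comment> \<open>\<open>?Z\<close> holds the code of a structure inside \<open>X\<close> together
    with the graph of a \<open>J\<close>-tuple in \<open>X\<close>. Its size is at most
    \<open>|X|\<close>, so its subsets can be coded by subsets of \<open>X\<close>.\<close>
  let ?Z = "(X <+> (dom (fun_ar K) \<times> lists X) <+> (dom (rel_ar K) \<times> lists X)) <+> J \<times> X"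
  have vocabulary: "|dom (fun_ar K) <+> dom (rel_ar K)| \<le>o |X|"
    using LS_bound(2) X ordLeq_transitive unfolding LST_bound_def by blast
  have "|dom (fun_ar K)| \<le>o |X|" "|dom (rel_ar K)| \<le>o |X|"
    using vocabulary card_of_Plus1 card_of_Plus2 ordLeq_transitive by blast+
  then have "|?Z| \<le>o |X|"
    using inf J card_of_lists_ordLeq[OF inf]
    by (intro card_of_Plus_ordLeq_infinite_Field card_of_Sigma_ordLeq_infinite ballI)
       (auto simp: Field_card_of card_of_card_order_on card_of_mono1)
  then obtain z where z: "inj_on z ?Z" "z ` ?Z \<subseteq> X"
    unfolding card_of_ordLeq[symmetric] by blast
  define D where "D = small_tuples J"
  define Q where "Q d N e P \<longleftrightarrow> le K N C \<and> d ` J \<subseteq> carrier N \<and> |carrier N| <o kb \<and>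
      inj_on e (carrier N) \<and> e ` carrier N \<subseteq> X \<and>
      is_struct K P \<and> carrier P = e ` carrier N \<and> isom K e N P" for d :: "'j \<Rightarrow> 'a" and N e P
  have "\<exists>N e P. Q d N e P" if d: "d \<in> D" for d
  proof -
    have "|d ` J| \<le>o |X|"
      using J card_of_image ordLeq_transitive by blast
    moreover have "d ` J \<subseteq> carrier C"
      using d by (auto simp: D_def small_tuples_def)
    ultimately obtain N where N: "le K N C" "d ` J \<subseteq> carrier N" "|carrier N| \<le>o |X|" "|carrier N| <o kb"
      using X d unfolding D_def small_tuples_def by (auto elim: ex_small_model)
    then obtain e where e: "inj_on e (carrier N)" "e ` carrier N \<subseteq> X"
      unfolding card_of_ordLeq[symmetric] by blast
    have "is_struct K N"
      using N(1) le_models models_struct by blast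
    from ex_isom_image[OF this e(1)]
    obtain P where "is_struct K P" "carrier P = e ` carrier N" "isom K e N P" .
    with N e have "Q d N e P"
      unfolding Q_def by blast
    then show ?thesis by blast
  qed
  then have "\<forall>d. \<exists>N e P. d \<in> D \<longrightarrow> Q d N e P"
    by blast
  then obtain N e P where "\<And>d. d \<in> D \<Longrightarrow> Q d (N d) (e d) (P d)"
    unfolding choice_iff by blast
  note NeP = this[unfolded Q_def]
  have N: "le K (N d) C" "d ` J \<subseteq> carrier (N d)" "|carrier (N d)| <o kb"
    and e: "inj_on (e d) (carrier (N d))" "e d ` carrier (N d) \<subseteq> X"
    and P: "is_struct K (P d)" "carrier (P d) = e d ` carrier (N d)" "isom K (e d) (N d) (P d)"
    if "d \<in> D" for d
    using NeP[OF that] by - (elim conjE, assumption)+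
  let ?c = "\<lambda>d. struct_code K (P d) <+> (\<lambda>j. (j, e d (d j))) ` J"
  have sub: "?c d \<subseteq> ?Z" if "d \<in> D" for d
  proof -
    have "struct_code K (P d) \<subseteq> X <+> (dom (fun_ar K) \<times> lists X) <+> (dom (rel_ar K) \<times> lists X)"
      using P(1,2)[OF that] e(2)[OF that] by (intro struct_code_subset) simp_all
    moreover have "(\<lambda>j. (j, e d (d j))) ` J \<subseteq> J \<times> X"
      using N(2)[OF that] e(2)[OF that] by blast
    ultimately show ?thesis by (auto simp: Plus_def)
  qed
  have "tuple_code J X (\<lambda>d. z ` ?c d)"
    unfolding tuple_code_def D_def[symmetric]
  proof (intro conjI ballI impI)
    fix d assume "d \<in> D"
    then show "z ` ?c d \<subseteq> X"
      using sub z(2) by blast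
  next
    fix d d' assume d: "d \<in> D" and d': "d' \<in> D" and eq: "z ` ?c d = z ` ?c d'"
    have "?c d = ?c d'"
      using inj_on_image_eq_iff[OF z(1) sub[OF d] sub[OF d']] eq by (rule iffD1)
    then have eqs: "struct_code K (P d) = struct_code K (P d') \<and>
        (\<lambda>j. (j, e d (d j))) ` J = (\<lambda>j. (j, e d' (d' j))) ` J"
      unfolding Plus_eq_iff .
    note graph = conjunct2[OF eqs]
    have PP: "P d = P d'"
      using P(1)[OF d] P(1)[OF d'] conjunct1[OF eqs] by (rule struct_code_inject)
    \<comment> \<open>Both models are copied to the same structure \<open>P d\<close>, so following
      \<open>e d\<close> by the inverse of \<open>e d'\<close> is an isomorphism; equal graphs make
      it carry \<open>d\<close> to \<open>d'\<close>.\<close>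
    let ?f = "inv_into (carrier (N d')) (e d') \<circ> e d"
    have "is_struct K (N d')"
      using le_models[OF N(1)[OF d']] models_struct by simp
    then have "isom K (inv_into (carrier (N d')) (e d')) (P d') (N d')"
      using P(3)[OF d'] by (rule isom_inv)
    then have f: "isom K ?f (N d) (N d')"
      using P(3)[OF d] PP isom_comp by simp
    obtain g where g: "isom K g C C" "\<And>x. x \<in> carrier (N d) \<Longrightarrow> g x = ?f x"
      using homogeneity[OF N(1)[OF d] N(3)[OF d] N(1)[OF d'] f] by blast
    have "g (d j) = d' j" if "j \<in> J" for j
    proof -
      have "(j, e d (d j)) \<in> (\<lambda>j. (j, e d' (d' j))) ` J"
        using graph that by blast
      then have "e d (d j) = e d' (d' j)" by auto
      moreover have "d j \<in> carrier (N d)" "d' j \<in> carrier (N d')"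
        using N(2)[OF d] N(2)[OF d'] that by blast+
      ultimately show ?thesis
        using g(2) e(1)[OF d'] by simp
    qed
    with g(1) show "\<exists>g. isom K g C C \<and> (\<forall>j\<in>J. g (d j) = d' j)" by blast
  qed
  then show ?thesis by blast
qed

section \<open>Automorphisms and equality of Galois types\<close>

lemma isom_C_closed: "isom K g C C \<Longrightarrow> x \<in> carrier C \<Longrightarrow> g x \<in> carrier C"
  by (auto simp: isom_def bij_betw_def)

lemma Aut_over_inv:
  assumes "g \<in> Aut_over K C A" and "A \<subseteq> carrier C"
  shows "inv_into (carrier C) g \<in> Aut_over K C A"
    and "\<And>x. x \<in> carrier C \<Longrightarrow> inv_into (carrier C) g (g x) = x"
proof -
  have g: "isom K g C C" "\<And>x. x \<in> A \<Longrightarrow> g x = x"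
    using assms(1) by (auto simp: Aut_over_def)
  then have inj: "inj_on g (carrier C)"
    by (simp add: isom_def bij_betw_def)
  then show l: "inv_into (carrier C) g (g x) = x" if "x \<in> carrier C" for x
    using that by simp
  have "inv_into (carrier C) g x = x" if "x \<in> A" for x
    using l[of x] that assms(2) g(2) by auto
  then show "inv_into (carrier C) g \<in> Aut_over K C A"
    using isom_inv[OF models_struct[OF C_model] g(1)] by (simp add: Aut_over_def)
qed

lemma gtp_eq_iff:
  assumes "b \<in> I \<rightarrow> carrier C" and "b' \<in> I \<rightarrow> carrier C" and "A \<subseteq> carrier C"
  shows "gtp K C I b A = gtp K C I b' A \<longleftrightarrow> (\<exists>g\<in>Aut_over K C A. \<forall>i\<in>I. g (b i) = b' i)"
proof
  assume eq: "gtp K C I b A = gtp K C I b' A"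
  have "id \<in> Aut_over K C A"
    by (simp add: Aut_over_def isom_id)
  then have "restrict (id \<circ> b') I \<in> snd (gtp K C I b' A)"
    unfolding gtp_def snd_conv by blast
  then obtain g where "g \<in> Aut_over K C A" "restrict (id \<circ> b') I = restrict (g \<circ> b) I"
    unfolding eq[symmetric] by (auto simp: gtp_def)
  then show "\<exists>g\<in>Aut_over K C A. \<forall>i\<in>I. g (b i) = b' i"
    by (metis comp_apply id_apply restrict_apply')
next
  \<comment> \<open>One inclusion of orbits, for arbitrary tuples, so that it applies to
    \<open>g\<close> and to its inverse.\<close>
  have sub: "snd (gtp K C I b' A) \<subseteq> snd (gtp K C I b A)"
    if g: "g \<in> Aut_over K C A" "\<And>i. i \<in> I \<Longrightarrow> g (b i) = b' i" for g b b'
  proof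
    fix c assume "c \<in> snd (gtp K C I b' A)"
    then obtain h where h: "h \<in> Aut_over K C A" "c = restrict (h \<circ> b') I"
      by (auto simp: gtp_def)
    have "c = restrict ((h \<circ> g) \<circ> b) I"
      using h(2) g(2) by (auto simp: restrict_def)
    moreover have "h \<circ> g \<in> Aut_over K C A"
      using g h isom_comp by (auto simp: Aut_over_def)
    ultimately show "c \<in> snd (gtp K C I b A)"
      by (auto simp: gtp_def)
  qed
  assume "\<exists>g\<in>Aut_over K C A. \<forall>i\<in>I. g (b i) = b' i"
  then obtain g where g: "g \<in> Aut_over K C A" "\<And>i. i \<in> I \<Longrightarrow> g (b i) = b' i"
    by blast
  have inv: "inv_into (carrier C) g (b' i) = b i" if "i \<in> I" for i
    using Aut_over_inv(2)[OF g(1) assms(3), of "b i"] g(2) that assms(1) by force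
  have "snd (gtp K C I b A) = snd (gtp K C I b' A)"
    using sub[OF g] sub[OF Aut_over_inv(1)[OF g(1) assms(3)] inv] by (intro equalityI)
  then show "gtp K C I b A = gtp K C I b' A"
    by (simp add: gtp_def)
qed

end

section \<open>Counting types over a model\<close>

locale stable_monster = monster K C kb
  for K :: "('a, 'f, 'r) aec" and C :: "('a, 'f, 'r) struct" and kb :: "'a rel" +
  fixes ind :: "('a, 'f, 'r) ind_rel"
  assumes stable: "almost_stable K C kb ind"
begin

section \<open>The axioms of the independence relation and the cardinal \<open>chi\<close>\<close>

lemma
  shows invariance: "\<forall>A M B g M'. small_set C kb A \<and> small_set C kb B \<and> small_sub K C kb M \<and>
      small_sub K C kb M' \<and> isom K g C C \<and> isom K g M M' \<and> ind A M B \<longrightarrow> ind (g ` A) M' (g ` B)"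
    and existence: "\<forall>(I::'a set) M N p. |I| <o kb \<and> small_sub K C kb M \<and> small_sub K C kb N \<and>
      le K M N \<and> p \<in> gS K C I M \<longrightarrow> (\<exists>q\<in>gS K C I N. extends q p \<and> does_not_fork ind I q M)"
  using stable[unfolded almost_stable_def independence_def] by - (elim conjE, assumption)+

lemma
  shows symmetry: "\<forall>A M B. small_set C kb A \<and> small_set C kb B \<and> small_sub K C kb M \<longrightarrow>
      (ind A M B \<longleftrightarrow> ind B M A)"
    and ind_nes: "\<forall>A M B. small_set C kb A \<and> small_set C kb B \<and> small_sub K C kb M \<and> ind A M B \<longrightarrow>
      nes K C A M B"
  using stable[unfolded almost_stable_def] by - (elim conjE, assumption)+

abbreviation chi :: "'a rel" where
  "chi \<equiv> kappa K C kb ind (ctwo :: bool rel)"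

text \<open>Provides a witness, so that \<open>chi\<close> is a genuine least cardinal. Existence
  with \<open>N = M\<close> shows that types over \<open>M\<close> do not fork over \<open>M\<close>
  itself. It speaks of index sets in the type of elements only, so the pair is re-indexed by two
  elements \<open>u\<close> and \<open>v\<close>.\<close>

lemma local_bound_UNIV: "local_bound K C kb ind ctwo |UNIV :: 'a set|"
  unfolding local_bound_def
proof (intro allI impI ballI)
  fix M and p :: "(bool, 'a) gtype"
  assume M: "small_sub K C kb M" and p: "p \<in> gS K C (Field ctwo) M"
  have F: "Field (ctwo :: bool rel) = UNIV"
    by (simp add: ctwo_def Field_card_of)
  obtain b where b: "p = gtp K C UNIV b (carrier M)" "b \<in> UNIV \<rightarrow> carrier C"
    using p unfolding gS_def F mem_Collect_eq by (elim exE conjE)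
  have "infinite (UNIV :: 'a set)"
    using Cinfinite_LS finite_subset[OF subset_UNIV] unfolding cinfinite_def by metis
  then obtain u v :: 'a where uv: "u \<noteq> v"
    using infinite_imp_nonempty[of "UNIV - {undefined}"] by auto
  define b' where "b' i = (if i = u then b True else b False)" for i
  have "le K M M"
    using M le_models le_refl by (auto simp: small_sub_def)
  moreover have "gtp K C {u, v} b' (carrier M) \<in> gS K C {u, v} M"
    unfolding gS_def using b(2) by (force simp: b'_def)
  moreover have "|{u, v}| <o kb"
    by (rule finite_ordLess_kb) simp
  ultimately obtain q where q: "q \<in> gS K C {u, v} M" "extends q (gtp K C {u, v} b' (carrier M))"
      "does_not_fork ind {u, v} q M"
    using existence M by blast
  then obtain c where c: "c \<in> snd q" "ind (c ` {u, v}) M (fst q)"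
    by (auto simp: does_not_fork_def)
  have "fst q = carrier M"
    using q(1) by (auto simp: gS_def gtp_def)
  \<comment> \<open>As \<open>q\<close> extends the type of \<open>b'\<close>, its realization
    \<open>c\<close> is the image of \<open>b'\<close> under some \<open>g\<close>; the same
    \<open>g\<close> applied to the original pair gives a realization of \<open>p\<close> with the
    same range.\<close>
  obtain g where g: "g \<in> Aut_over K C (carrier M)" "c = restrict (g \<circ> b') {u, v}"
    using c(1) q(2) by (auto simp: extends_def gtp_def)
  have "c ` {u, v} = restrict (g \<circ> b) UNIV ` UNIV"
    using uv g(2) by (auto simp: b'_def UNIV_bool)
  moreover have "restrict (g \<circ> b) UNIV \<in> snd p"
    unfolding b(1) gtp_def snd_conv using g(1) by blast
  moreover have "fst p = carrier M"
    by (simp add: b(1) gtp_def)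
  ultimately have "does_not_fork ind (Field ctwo) p M"
    using c(2) \<open>fst q = carrier M\<close> unfolding does_not_fork_def F
    by metis
  then show "\<exists>M0. le K M0 M \<and> |carrier M0| \<le>o |UNIV :: 'a set| \<and> does_not_fork ind (Field ctwo) p M0"
    using \<open>le K M M\<close> card_of_mono1[OF subset_UNIV] by blast
qed

lemma
  shows Card_order_chi: "Card_order chi" and LS_chi: "LS K \<le>o chi"
    and local_bound_chi: "local_bound K C kb ind ctwo chi"
proof -
  let ?P = "\<lambda>r. LS K \<le>o r \<and> local_bound K C kb ind (ctwo :: bool rel) r"
  have "LS K \<le>o |UNIV :: 'a set|"
    using card_of_Field_ordIso[OF LS_bound(1)] card_of_mono1[OF subset_UNIV]
      ordIso_symmetric ordIso_ordLeq_trans by blast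
  with local_bound_UNIV have "?P |UNIV :: 'a set|" by blast
  note least_card[of "|UNIV :: 'a set|" ?P, OF card_of_Card_order this]
  then show "Card_order chi" "LS K \<le>o chi" "local_bound K C kb ind ctwo chi"
    unfolding kappa_def by blast+
qed

lemma Cinfinite_chi: "Cinfinite chi"
  using Card_order_chi LS_chi cinfinite_mono Cinfinite_LS by blast

text \<open>Local character yields an independent realization of the type of the pair over
  \<open>M\<close>; an automorphism over \<open>M\<close> carries it back to \<open>a, a'\<close>,
  and invariance applies. With \<open>a = a'\<close> this serves single elements.\<close>

lemma ex_nonforking_base:
  assumes M: "small_sub K C kb M" and a: "a \<in> carrier C" "a' \<in> carrier C"
  obtains M0 where "le K M0 M" and "|carrier M0| \<le>o chi" and "ind {a, a'} M0 (carrier M)"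
proof -
  have MC: "carrier M \<subseteq> carrier C"
    using M le_carrier by (auto simp: small_sub_def)
  let ?b = "\<lambda>i. if i then a else a'"
  let ?p = "gtp K C (Field ctwo) ?b (carrier M)"
  have "?p \<in> gS K C (Field ctwo) M"
    using a by (auto simp: gS_def)
  then obtain M0 where M0: "le K M0 M" "|carrier M0| \<le>o chi" "does_not_fork ind (Field ctwo) ?p M0"
    using local_bound_chi M unfolding local_bound_def by blast
  then obtain g where g: "g \<in> Aut_over K C (carrier M)"
      "ind (restrict (g \<circ> ?b) UNIV ` UNIV) M0 (carrier M)"
    by (auto simp: does_not_fork_def gtp_def ctwo_def Field_card_of)
  let ?h = "inv_into (carrier C) g"
  note h = Aut_over_inv[OF g(1) MC]
  have "restrict (g \<circ> ?b) UNIV ` UNIV = {g a, g a'}"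
    by (auto simp: UNIV_bool)
  then have ind: "ind {g a, g a'} M0 (carrier M)"
    using g(2) by simp
  have "g a \<in> carrier C" "g a' \<in> carrier C"
    using g(1) a isom_C_closed by (auto simp: Aut_over_def)
  then have small: "small_set C kb {g a, g a'}" "small_set C kb (carrier M)" "small_sub K C kb M0"
    using M MC M0(1) le_trans le_carrier[OF M0(1)] finite_ordLess_kb[of "{g a, g a'}"]
      ordLeq_ordLess_trans[OF card_of_mono1]
    by (auto simp: small_set_def small_sub_def)
  have fix_h: "?h x = x" if "x \<in> carrier M" for x
    using h(1) that by (simp add: Aut_over_def)
  have "isom K ?h M0 M0"
    using M0(1) le_models models_struct fix_h le_carrier[OF M0(1)]
    by (intro isom_fixing_substruct) auto
  then have "ind (?h ` {g a, g a'}) M0 (?h ` carrier M)"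
    using invariance small ind h(1) unfolding Aut_over_def by blast
  moreover have "?h ` {g a, g a'} = {a, a'}"
    using h(2) a by simp
  moreover have "?h ` carrier M = carrier M"
    using fix_h by simp
  ultimately show ?thesis
    using M0(1,2) that by simp
qed

text \<open>By symmetry \<open>M\<close> is independent from \<open>{a, a'}\<close> over
  \<open>M1\<close>, hence does not explicitly split from it: as \<open>a\<close> and
  \<open>a'\<close> have the same type over \<open>M1\<close>, so do \<open>M\<close> with
  \<open>a\<close> and \<open>M\<close> with \<open>a'\<close>. An automorphism witnessing this
  fixes \<open>M\<close> pointwise.\<close>

lemma conjugate_over_base_lift:
  assumes M: "small_sub K C kb M" and "le K M1 M" and "ind {a, a'} M1 (carrier M)"
    and g: "g \<in> Aut_over K C (carrier M1)" "g a = a'" and a: "a \<in> carrier C" "a' \<in> carrier C"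
  obtains f where "f \<in> Aut_over K C (carrier M)" and "f a = a'"
proof -
  have MC: "carrier M \<subseteq> carrier C"
    using M le_carrier by (auto simp: small_sub_def)
  have M1C: "carrier M1 \<subseteq> carrier C"
    using MC assms(2) le_carrier by blast
  have small: "small_set C kb {a, a'}" "small_set C kb (carrier M)" "small_sub K C kb M1"
    using M MC a assms(2) le_trans le_carrier[OF assms(2)] finite_ordLess_kb[of "{a, a'}"]
      ordLeq_ordLess_trans[OF card_of_mono1]
    by (auto simp: small_set_def small_sub_def)
  have "ind (carrier M) M1 {a, a'}"
    using symmetry small assms(3) by blast
  then have nes: "nes K C (carrier M) M1 {a, a'}"
    using ind_nes small by blast
  have "gtp K C {a} (\<lambda>_. a) (carrier M1) = gtp K C {a} (\<lambda>_. a') (carrier M1)"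
    using a g M1C by (subst gtp_eq_iff) auto
  then have "gtp K C (carrier M <+> {a}) (case_sum id (\<lambda>_. a)) (carrier M1) =
      gtp K C (carrier M <+> {a}) (case_sum id (\<lambda>_. a')) (carrier M1)"
    using nes[unfolded nes_def, rule_format, of "\<lambda>_. a" "{a}" "\<lambda>_. a'"] by simp
  moreover have "case_sum id (\<lambda>_. a) \<in> carrier M <+> {a} \<rightarrow> carrier C"
    "case_sum id (\<lambda>_. a') \<in> carrier M <+> {a} \<rightarrow> carrier C"
    using a MC by (auto split: sum.splits)
  ultimately obtain f where f: "f \<in> Aut_over K C (carrier M1)"
      "\<forall>i\<in>carrier M <+> {a}. f (case_sum id (\<lambda>_. a) i) = case_sum id (\<lambda>_. a') i"
    using M1C by (subst (asm) gtp_eq_iff) auto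
  have "f x = x" if "x \<in> carrier M" for x
    using f(2)[rule_format, of "Inl x"] that by auto
  moreover have "f a = a'"
    using f(2)[rule_format, of "Inr a"] by auto
  ultimately show ?thesis
    using f(1) that by (auto simp: Aut_over_def)
qed

text \<open>Since \<open>a\<close> does not explicitly split from \<open>M\<close> over
  \<open>M0\<close>, an automorphism over \<open>M0\<close> from \<open>h\<close> to
  \<open>h'\<close> can be replaced by one that fixes \<open>a\<close> as well.\<close>

lemma nonforking_tuple_conjugate:
  fixes X :: "'a set"
  assumes M: "small_sub K C kb M" and "le K M0 M" and "ind {a} M0 (carrier M)" and a: "a \<in> carrier C"
    and h: "h \<in> X \<rightarrow> carrier M" "h' \<in> X \<rightarrow> carrier M"
    and g: "g \<in> Aut_over K C (carrier M0)" "\<And>x. x \<in> X \<Longrightarrow> g (h x) = h' x"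
  obtains f where "f \<in> Aut_over K C (carrier M0)" and "f a = a" and "\<And>x. x \<in> X \<Longrightarrow> f (h x) = h' x"
proof -
  have MC: "carrier M \<subseteq> carrier C"
    using M le_carrier by (auto simp: small_sub_def)
  have M0C: "carrier M0 \<subseteq> carrier C"
    using MC assms(2) le_carrier by blast
  have small: "small_set C kb {a}" "small_set C kb (carrier M)" "small_sub K C kb M0"
    using M MC a assms(2) le_trans le_carrier[OF assms(2)] finite_ordLess_kb[of "{a}"]
      ordLeq_ordLess_trans[OF card_of_mono1]
    by (auto simp: small_set_def small_sub_def)
  then have nes: "nes K C {a} M0 (carrier M)"
    using ind_nes assms(3) by blast
  have hC: "h \<in> X \<rightarrow> carrier C" "h' \<in> X \<rightarrow> carrier C"
    using h MC by auto
  have "gtp K C X h (carrier M0) = gtp K C X h' (carrier M0)"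
    using g by (subst gtp_eq_iff[OF hC M0C]) auto
  then have "gtp K C ({a} <+> X) (case_sum id h) (carrier M0) =
      gtp K C ({a} <+> X) (case_sum id h') (carrier M0)"
    using nes[unfolded nes_def, rule_format, of h X h'] h by simp
  moreover have "case_sum id h \<in> {a} <+> X \<rightarrow> carrier C" "case_sum id h' \<in> {a} <+> X \<rightarrow> carrier C"
    using a hC by (auto split: sum.splits)
  ultimately obtain f where f: "f \<in> Aut_over K C (carrier M0)"
      "\<forall>i\<in>{a} <+> X. f (case_sum id h i) = case_sum id h' i"
    using M0C by (subst (asm) gtp_eq_iff) auto
  have "f a = a"
    using f(2)[rule_format, of "Inl a"] by auto
  moreover have "f (h x) = h' x" if "x \<in> X" for x
    using f(2)[rule_format, of "Inr x"] that by auto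
  ultimately show ?thesis
    using f(1) that by blast
qed

section \<open>Cardinal arithmetic for the number of types\<close>

lemma Cinfinite_type_bound:
  assumes "Card_order lam" and "cinfinite lam"
  shows "Cinfinite (lam ^c (ctwo ^c chi))"
proof (rule Cinfinite_cexp)
  show "ctwo \<le>o lam"
    using assms by (intro ctwo_ordLeq_Cinfinite) simp
  show "Cinfinite (ctwo ^c chi)"
    using Cinfinite_chi by (intro Cinfinite_cexp ordLeq_refl Card_order_ctwo)
qed

text \<open>The invariant of an element will contain a set of pairs of subsets of
  \<open>Field chi\<close>. There are \<open>2^(2^chi)\<close> such sets, and 2 is at most
  \<open>lam\<close> because \<open>lam\<close> is infinite.\<close>

lemma card_of_Pow_Pow_chi:
  assumes "Card_order lam" and "cinfinite lam"
  shows "|Pow (Pow (Field chi) \<times> Pow (Field chi))| \<le>o lam ^c (ctwo ^c chi)"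
proof -
  have pow: "|Pow (Field chi)| =o ctwo ^c chi"
    unfolding ctwo_def cexp_def Field_card_of by (rule card_of_Pow_Func)
  have "infinite (Pow (Field chi))"
    using Cinfinite_chi by (simp add: cinfinite_def)
  then have "|Pow (Field chi) \<times> Pow (Field chi)| \<le>o |Pow (Field chi)|"
    by (intro card_of_Sigma_ordLeq_infinite) (auto simp: card_of_mono1)
  then have "|Pow (Pow (Field chi) \<times> Pow (Field chi))| \<le>o |Pow (Pow (Field chi))|"
    by (rule card_of_Pow_ordLeq)
  also have "|Pow (Pow (Field chi))| =o ctwo ^c |Pow (Field chi)|"
    unfolding ctwo_def cexp_def Field_card_of by (rule card_of_Pow_Func)
  also have "ctwo ^c |Pow (Field chi)| =o ctwo ^c (ctwo ^c chi)"
    by (intro cexp_cong2 pow card_of_Card_order Card_order_ctwo)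
  also have "ctwo ^c (ctwo ^c chi) \<le>o lam ^c (ctwo ^c chi)"
    using assms by (intro cexp_mono1 ctwo_ordLeq_Cinfinite Card_order_cexp) simp
  finally show ?thesis .
qed

text \<open>\<open>A\<close> represents the types of single elements over \<open>M\<close>. To each
  \<open>a\<close> is attached an invariant \<open>T a\<close>, which has few possible values and
  determines the type of \<open>a\<close> over \<open>M\<close>; \<open>A\<close> takes one element
  for each value.\<close>

lemma ex_type_representatives:
  fixes lam :: "'l rel"
  assumes M: "small_sub K C kb M" and lam: "|carrier M| =o lam" "Card_order lam" "cinfinite lam"
  shows "\<exists>A\<subseteq>carrier C. |A| \<le>o lam ^c (ctwo ^c chi) \<and>
    (\<forall>a\<in>carrier C. \<exists>a'\<in>A. \<exists>g\<in>Aut_over K C (carrier M). g a = a')"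
proof -
  \<comment> \<open>\<open>X\<close> serves twice: it indexes the enumerations of submodels of size
    at most \<open>chi\<close>, and its subsets are the codes.\<close>
  define X where "X = Field chi"
  have chi_X: "chi =o |X|"
    using card_of_Field_ordIso[OF Card_order_chi] ordIso_symmetric unfolding X_def by blast
  have LS_X: "LS K \<le>o |X|"
    using LS_chi chi_X by (rule ordLeq_ordIso_trans)
  have infX: "infinite X"
    using Cinfinite_chi by (simp add: cinfinite_def X_def)
  have MC: "carrier M \<subseteq> carrier C"
    using M le_carrier by (auto simp: small_sub_def)
  have Mkb: "|carrier M| <o kb"
    using M by (simp add: small_sub_def)
  have XX: "|X <+> X| \<le>o |X|"
    using infX by (intro card_of_Plus_ordLeq_infinite_Field)
      (auto simp: Field_card_of card_of_card_order_on card_of_mono1)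
  have "|(X <+> X) <+> {()}| \<le>o |X|"
    by (rule card_of_Plus_ordLeq_infinite_Field) (use infX XX in
      \<open>auto simp: Field_card_of card_of_card_order_on intro: card_of_singl_ordLeq\<close>)
  from ex_tuple_code[OF LS_X this] obtain code2 where code2: "tuple_code ((X <+> X) <+> {()}) X code2"
    by blast
  from ex_tuple_code[OF LS_X XX] obtain code1 where code1: "tuple_code (X <+> X) X code1"
    by blast
  define F where "F = Func X (carrier M)"
  have F: "m x \<in> carrier M" if "m \<in> F" "x \<in> X" for m x
    using that by (auto simp: F_def Func_def)
  \<comment> \<open>Enumerations may repeat, so smaller submodels are covered too; the universe is
    nonempty, which gives the surjection.\<close>
  have enum: "\<exists>m\<in>F. carrier N = m ` X" if N: "le K N M" "|carrier N| \<le>o |X|" for N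
  proof -
    have "carrier N \<noteq> {}"
      using N(1) le_models models_struct unfolding is_struct_def by blast
    then obtain f where f: "f ` X = carrier N"
      using N(2) card_of_ordLeq2 by metis
    let ?m = "\<lambda>x. if x \<in> X then f x else undefined"
    have "?m \<in> F"
      using f le_carrier[OF N(1)] by (auto simp: F_def Func_def)
    moreover have "?m ` X = carrier N"
      using f by auto
    ultimately show ?thesis by blast
  qed
  define d1 where "d1 m h = case_sum m h" for m h :: "'a \<Rightarrow> 'a"
  define d2 where "d2 m h a = case_sum (case_sum m h) (\<lambda>_::unit. a)" for m h :: "'a \<Rightarrow> 'a" and a
  have d1: "d1 m h \<in> small_tuples (X <+> X)" if "m \<in> F" "h \<in> F" for m h
  proof -
    have "d1 m h \<in> X <+> X \<rightarrow> carrier M"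
      using F[OF that(1)] F[OF that(2)] by (auto simp: d1_def)
    then have "d1 m h ` (X <+> X) \<subseteq> carrier M" by blast
    then show ?thesis
      using MC ordLeq_ordLess_trans[OF card_of_mono1 Mkb] by (auto simp: small_tuples_def)
  qed
  have d2: "d2 m h a \<in> small_tuples ((X <+> X) <+> {()})"
    if "m \<in> F" "h \<in> F" "a \<in> carrier C" for m h a
  proof -
    have "d2 m h a \<in> (X <+> X) <+> {()} \<rightarrow> carrier M \<union> {a}"
      using F[OF that(1)] F[OF that(2)] by (auto simp: d2_def)
    then have sub: "d2 m h a ` ((X <+> X) <+> {()}) \<subseteq> carrier M \<union> {a}" by blast
    have "|carrier M \<union> {a}| <o kb"
      using Mkb finite_ordLess_kb[of "{a}"] Cinfinite_kb by (intro Un_Cinfinite_bound_strict) auto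
    then have "|d2 m h a ` ((X <+> X) <+> {()})| <o kb"
      using card_of_mono1[OF sub] ordLeq_ordLess_trans by blast
    moreover have "d2 m h a ` ((X <+> X) <+> {()}) \<subseteq> carrier C"
      by (rule subset_trans[OF sub]) (use MC that(3) in simp)
    ultimately show ?thesis
      unfolding small_tuples_def mem_Collect_eq by (intro conjI funcsetI) (erule subsetD, rule imageI)
  qed
  have "\<exists>m. m \<in> F \<and> (\<exists>M0. le K M0 M \<and> carrier M0 = m ` X \<and> ind {a} M0 (carrier M))"
    if a: "a \<in> carrier C" for a
  proof -
    obtain M0 where M0: "le K M0 M" "|carrier M0| \<le>o chi" "ind {a, a} M0 (carrier M)"
      using ex_nonforking_base[OF M a a] .
    then show ?thesis
      using enum[OF M0(1) ordLeq_ordIso_trans[OF M0(2) chi_X]] by auto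
  qed
  then obtain m where m: "\<And>a. a \<in> carrier C \<Longrightarrow>
      m a \<in> F \<and> (\<exists>M0. le K M0 M \<and> carrier M0 = m a ` X \<and> ind {a} M0 (carrier M))"
    by metis
  \<comment> \<open>Records which code of \<open>(m a, h)\<close> occurs with which code of
    \<open>(m a, h, a)\<close>, for all \<open>h\<close> at once. Conjugate tuples may have
    different codes, so this is a relation that need not be a function.\<close>
  define R where "R a = (\<lambda>h. (code1 (d1 (m a) h), code2 (d2 (m a) h a))) ` F" for a
  define T where "T a = (m a, R a)" for a
  have conj: "\<exists>g\<in>Aut_over K C (carrier M). g a = a'"
    if a: "a \<in> carrier C" "a' \<in> carrier C" and T: "T a = T a'" for a a'
  proof -
    have mm: "m a' = m a" and R: "R a = R a'"
      using T by (simp_all add: T_def)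
    have mF: "m a \<in> F"
      using m[OF a(1)] by blast
    obtain M0 where M0: "le K M0 M" "carrier M0 = m a ` X" "ind {a'} M0 (carrier M)"
      using m[OF a(2)] mm by auto
    obtain M1 where M1: "le K M1 M" "|carrier M1| \<le>o chi" "ind {a, a'} M1 (carrier M)"
      using ex_nonforking_base[OF M a] .
    obtain h where h: "h \<in> F" "carrier M1 = h ` X"
      using enum[OF M1(1) ordLeq_ordIso_trans[OF M1(2) chi_X]] by blast
    \<comment> \<open>The pair of codes that \<open>a\<close> yields at \<open>h\<close> is also
      yielded by \<open>a'\<close>, but possibly at another sequence \<open>h'\<close>. What follows
      undoes the passage from \<open>h\<close> to \<open>h'\<close>.\<close>
    have "(code1 (d1 (m a) h), code2 (d2 (m a) h a)) \<in> R a'"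
      unfolding R[symmetric] using h(1) by (simp add: R_def)
    then obtain h' where h': "h' \<in> F" "code1 (d1 (m a) h) = code1 (d1 (m a) h')"
        "code2 (d2 (m a) h a) = code2 (d2 (m a) h' a')"
      unfolding R_def mm by blast
    obtain g1 where g1: "isom K g1 C C" "\<forall>j\<in>X <+> X. g1 (d1 (m a) h j) = d1 (m a) h' j"
      using code1 d1[OF mF h(1)] d1[OF mF h'(1)] h'(2) unfolding tuple_code_def by blast
    obtain g2 where g2: "isom K g2 C C"
        "\<forall>j\<in>(X <+> X) <+> {()}. g2 (d2 (m a) h a j) = d2 (m a) h' a' j"
      using code2 d2[OF mF h(1) a(1)] d2[OF mF h'(1) a(2)] h'(3) unfolding tuple_code_def by blast
    have g1_m: "g1 (m a x) = m a x" and g1_h: "g1 (h x) = h' x" if "x \<in> X" for x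
      using g1(2)[rule_format, of "Inl x"] g1(2)[rule_format, of "Inr x"] that
      by (simp_all add: d1_def InlI InrI)
    have g2_m: "g2 (m a x) = m a x" and g2_h: "g2 (h x) = h' x" if "x \<in> X" for x
      using g2(2)[rule_format, of "Inl (Inl x)"] g2(2)[rule_format, of "Inl (Inr x)"] that
      by (simp_all add: d2_def InlI InrI)
    have g2_a: "g2 a = a'"
      using g2(2)[rule_format, of "Inr ()"] by (simp add: d2_def InrI)
    have "g1 \<in> Aut_over K C (carrier M0)"
      using g1(1) g1_m M0(2) by (auto simp: Aut_over_def)
    moreover have "h \<in> X \<rightarrow> carrier M" "h' \<in> X \<rightarrow> carrier M"
      using F h(1) h'(1) by auto
    \<comment> \<open>\<open>g1\<close> moves \<open>h\<close> to \<open>h'\<close> over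
      \<open>M0\<close>. As \<open>a'\<close> is independent from \<open>M\<close> over
      \<open>M0\<close>, some automorphism does so while fixing \<open>a'\<close>.\<close>
    ultimately obtain f where f: "f \<in> Aut_over K C (carrier M0)" "f a' = a'"
        "\<And>x. x \<in> X \<Longrightarrow> f (h x) = h' x"
      using nonforking_tuple_conjugate[OF M M0(1,3) a(2), of h X h' g1] g1_h by metis
    let ?f = "inv_into (carrier C) f"
    have inv: "?f \<in> Aut_over K C (carrier M0)" "\<And>x. x \<in> carrier C \<Longrightarrow> ?f (f x) = x"
      using Aut_over_inv[OF f(1)] MC le_carrier[OF M0(1)] by blast+
    \<comment> \<open>\<open>g2\<close> takes \<open>h, a\<close> to \<open>h', a'\<close>, and the
      inverse of \<open>f\<close> takes \<open>h'\<close> back to \<open>h\<close> and fixes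
      \<open>a'\<close>. The composition therefore fixes \<open>M1\<close> pointwise.\<close>
    have "(?f \<circ> g2) a = a'"
      using inv(2)[OF a(2)] f(2) g2_a by simp
    moreover have "(?f \<circ> g2) (h x) = h x" if "x \<in> X" for x
      using inv(2)[of "h x"] f(3)[OF that] g2_h[OF that] F[OF h(1) that] MC by auto
    moreover have "isom K (?f \<circ> g2) C C"
      using g2(1) inv(1) isom_comp by (auto simp: Aut_over_def)
    ultimately have "?f \<circ> g2 \<in> Aut_over K C (carrier M1)" "(?f \<circ> g2) a = a'"
      using h(2) by (auto simp: Aut_over_def)
    \<comment> \<open>\<open>M1\<close> was chosen as a base for the pair \<open>a, a'\<close>, so
      conjugacy over \<open>M1\<close> lifts to \<open>M\<close>.\<close>
    from conjugate_over_base_lift[OF M M1(1,3) this a]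
    show ?thesis by blast
  qed
  have T_sub: "T ` carrier C \<subseteq> F \<times> Pow (Pow X \<times> Pow X)"
  proof
    fix t assume "t \<in> T ` carrier C"
    then obtain a where a: "a \<in> carrier C" "t = T a" by blast
    have mF: "m a \<in> F"
      using m[OF a(1)] by blast
    have "code1 (d1 (m a) h) \<subseteq> X" "code2 (d2 (m a) h a) \<subseteq> X" if "h \<in> F" for h
      using code1 code2 d1[OF mF that] d2[OF mF that a(1)] unfolding tuple_code_def by simp_all
    then have "R a \<subseteq> Pow X \<times> Pow X"
      by (auto simp: R_def)
    then show "t \<in> F \<times> Pow (Pow X \<times> Pow X)"
      using mF a(2) by (simp add: T_def)
  qed
  have chi_le: "chi \<le>o ctwo ^c chi"
    using ordLess_ctwo_cexp[OF Card_order_chi] ordLess_imp_ordLeq by blast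
  have "|F| \<le>o lam ^c (ctwo ^c chi)"
  proof -
    have "|F| = |carrier M| ^c chi"
      by (simp add: cexp_def F_def X_def Field_card_of)
    also have "|carrier M| ^c chi =o lam ^c chi"
      using lam(1) Card_order_chi by (rule cexp_cong1)
    also have "lam ^c chi \<le>o lam ^c (ctwo ^c chi)"
      using chi_le lam(2) Cinfinite_Cnotzero[OF Cinfinite_chi] by (rule cexp_mono2_Cnotzero)
    finally show ?thesis .
  qed
  moreover have "Cinfinite (lam ^c (ctwo ^c chi))"
    using lam(2,3) by (rule Cinfinite_type_bound)
  ultimately have "|F \<times> Pow (Pow X \<times> Pow X)| \<le>o lam ^c (ctwo ^c chi)"
    using card_of_Pow_Pow_chi[OF lam(2,3)] unfolding X_def cinfinite_def
    by (intro card_of_Times_ordLeq_infinite_Field) auto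
  then have T_le: "|T ` carrier C| \<le>o lam ^c (ctwo ^c chi)"
    using card_of_mono1[OF T_sub] ordLeq_transitive by blast
  define A where "A = inv_into (carrier C) T ` T ` carrier C"
  show ?thesis
  proof (intro exI[of _ A] conjI ballI)
    show "A \<subseteq> carrier C"
      by (auto simp: A_def inv_into_into)
    show "|A| \<le>o lam ^c (ctwo ^c chi)"
      using card_of_image T_le ordLeq_transitive unfolding A_def by blast
    fix a assume a: "a \<in> carrier C"
    let ?a' = "inv_into (carrier C) T (T a)"
    have a': "?a' \<in> A" "?a' \<in> carrier C"
      using a by (auto simp: A_def inv_into_into)
    have "T a = T ?a'"
      using a by (simp add: f_inv_into_f)
    then show "\<exists>a'\<in>A. \<exists>g\<in>Aut_over K C (carrier M). g a = a'"
      using conj[OF a a'(2)] a'(1) by (intro bexI[of _ ?a'])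
  qed
qed

end

section \<open>The bound\<close>

lemma Card_order_card_pred:
  assumes "Card_order \<kappa>"
  shows "Card_order (card_pred \<kappa>)"
  using assms someI_ex[of "\<lambda>t. Card_order t \<and> \<kappa> =o cardSuc t"]
  unfolding card_pred_def by auto

text \<open>For a successor, a strict bound is a weak bound by the predecessor; otherwise
  \<open>card_pred\<close> changes nothing.\<close>

lemma ordLess_imp_ordLeq_card_pred:
  fixes \<kappa> :: "'k rel"
  assumes "|A| <o \<kappa>"
  shows "|A| \<le>o card_pred \<kappa>"
proof (cases "\<exists>t::'k rel. Card_order t \<and> \<kappa> =o cardSuc t")
  case True
  have pred: "Card_order (card_pred \<kappa>) \<and> \<kappa> =o cardSuc (card_pred \<kappa>)"
    using someI_ex[OF True] unfolding card_pred_def if_P[OF True] .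
  have "|A| <o cardSuc (card_pred \<kappa>)"
    using assms conjunct2[OF pred] by (rule ordLess_ordIso_trans)
  then show ?thesis
    using cardSuc_ordLeq_ordLess[OF conjunct1[OF pred] card_of_Card_order] by blast
next
  case False
  show ?thesis
    unfolding card_pred_def if_not_P[OF False] using assms by (rule ordLess_imp_ordLeq)
qed

text \<open>\<open>card_Sup\<close> is least among cardinals on the type \<open>'b\<close>, while
  \<open>r\<close> may live on another type. If \<open>r\<close> fits into \<open>'b\<close>, a copy
  of it there is an upper bound; otherwise the whole type is one, and it is at most
  \<open>r\<close>.\<close>

lemma card_Sup_ordLeq:
  fixes F :: "'b set set" and r :: "'c rel"
  assumes r: "Card_order r" and F: "\<And>X. X \<in> F \<Longrightarrow> |X| \<le>o r"
  shows "card_Sup F \<le>o r"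
proof (cases "r \<le>o |UNIV :: 'b set|")
  case True
  then have "|Field r| \<le>o |UNIV :: 'b set|"
    using card_of_Field_ordIso[OF r] ordIso_ordLeq_trans by blast
  then obtain f :: "'c \<Rightarrow> 'b" where f: "inj_on f (Field r)"
    unfolding card_of_ordLeq[symmetric] by blast
  have "r =o |f ` Field r|"
    using f card_of_Field_ordIso[OF r] card_of_ordIsoI[OF inj_on_imp_bij_betw]
      ordIso_symmetric ordIso_transitive by blast
  then have "|X| \<le>o |f ` Field r|" if "X \<in> F" for X
    using F[OF that] ordLeq_ordIso_trans by blast
  then have "card_Sup F \<le>o |f ` Field r|"
    unfolding card_Sup_def by (intro least_card(3) card_of_Card_order) blast
  then show ?thesis
    using \<open>r =o |f ` Field r|\<close> ordIso_symmetric ordLeq_ordIso_trans by blast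
next
  case False
  have "card_Sup F \<le>o |UNIV :: 'b set|"
    unfolding card_Sup_def
    by (intro least_card(3) card_of_Card_order ballI card_of_mono1 subset_UNIV)
  moreover have "|UNIV :: 'b set| \<le>o r"
    using False r card_of_Well_order ordLeq_total unfolding card_order_on_def by blast
  ultimately show ?thesis
    by (rule ordLeq_transitive)
qed

theorem theorem4p13:
  fixes K :: "('a, 'f, 'r) aec" and C :: "('a, 'f, 'r) struct" and kb :: "'a rel"
    and ind :: "('a, 'f, 'r) ind_rel"
    and \<mu> :: "'m rel" and lam :: "'l rel" and \<kappa> :: "'k rel"
  assumes "is_aec K"
    and "joint_embedding K kb" and "amalgamation K kb" and "no_maximal_models K kb"
    and "is_monster K C kb"
    and "almost_stable K C kb ind"
    and "Card_order \<mu>" and "Card_order lam" and "Card_order \<kappa>"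
    and "LS K \<le>o \<mu>" and "\<mu> \<le>o lam" and "lam <o kb"
  shows "NT K C \<mu> lam \<kappa> \<le>o lam ^c (ctwo ^c kappa K C kb ind ctwo) +c card_pred \<kappa>"
proof -
  interpret stable_monster K C kb ind
    by unfold_locales (fact assms)+
  let ?t = "lam ^c (ctwo ^c chi)"
  have "LS K \<le>o lam"
    using assms(10,11) by (rule ordLeq_transitive)
  then have inf: "cinfinite lam"
    using Cinfinite_LS cinfinite_mono by blast
  have t: "Cinfinite ?t"
    using assms(8) inf by (rule Cinfinite_type_bound)
  then have b: "Cinfinite (?t +c card_pred \<kappa>)"
    by (rule Cinfinite_csum1)
  have "?t \<le>o ?t +c card_pred \<kappa>"
    using t by (intro ordLeq_csum1) simp
  have pred: "card_pred \<kappa> \<le>o ?t +c card_pred \<kappa>"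
    using Card_order_card_pred[OF assms(9)] by (rule ordLeq_csum2)
  have "|\<Gamma>| \<le>o ?t +c card_pred \<kappa>"
    if M: "le K M C" "|carrier M| =o lam" and \<Gamma>: "\<Gamma> \<subseteq> S_le K C M \<mu>"
      and incons: "\<And>\<Delta>. \<Delta> \<subseteq> \<Gamma> \<Longrightarrow> \<kappa> \<le>o |\<Delta>| \<Longrightarrow> \<not> consistent C \<Delta>" for M \<Gamma>
  proof -
    have "small_sub K C kb M"
      using M assms(12) ordIso_ordLess_trans by (auto simp: small_sub_def)
    from ex_type_representatives[OF this M(2) assms(8) inf]
    obtain A where A: "A \<subseteq> carrier C" "|A| \<le>o ?t"
      "\<forall>a\<in>carrier C. \<exists>a'\<in>A. \<exists>g\<in>Aut_over K C (carrier M). g a = a'"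
      by blast
    \<comment> \<open>Each \<open>?\<Delta> a\<close> is realized by \<open>a\<close>, hence
      consistent, and so has size below \<open>\<kappa>\<close>.\<close>
    let ?\<Delta> = "\<lambda>a. {p \<in> \<Gamma>. (\<lambda>_. a) \<in> snd p}"
    have "\<Gamma> \<subseteq> (\<Union>a\<in>A. ?\<Delta> a)"
    proof
      fix p assume p: "p \<in> \<Gamma>"
      then obtain a N where a: "p = gtp1 K C a (carrier N)" "a \<in> carrier C" "le K N M"
        using \<Gamma> by (auto simp: S_le_def)
      then obtain a' g where g: "a' \<in> A" "g \<in> Aut_over K C (carrier M)" "g a = a'"
        using A(3) by blast
      \<comment> \<open>Fixing \<open>M\<close> fixes its submodel \<open>N\<close>, so the
        representative \<open>a'\<close> realizes \<open>p\<close> too.\<close>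
      have "g \<in> Aut_over K C (carrier N)"
        using g(2) le_carrier[OF a(3)] by (auto simp: Aut_over_def)
      moreover have "(\<lambda>_. a') = restrict (g \<circ> (\<lambda>_. a)) (UNIV :: unit set)"
        using g(3) by auto
      ultimately have "(\<lambda>_. a') \<in> snd p"
        unfolding a(1) gtp1_def gtp_def snd_conv by blast
      then show "p \<in> (\<Union>a\<in>A. ?\<Delta> a)"
        using p g(1) by blast
    qed
    moreover have "|\<Union>a\<in>A. ?\<Delta> a| \<le>o ?t +c card_pred \<kappa>"
    proof (intro UNION_Cinfinite_bound ballI)
      show "|A| \<le>o ?t +c card_pred \<kappa>"
        using A(2) \<open>?t \<le>o ?t +c card_pred \<kappa>\<close> by (rule ordLeq_transitive)
      fix a assume "a \<in> A"
      then have "consistent C (?\<Delta> a)"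
        using A(1) by (auto simp: consistent_def)
      then have "\<not> \<kappa> \<le>o |?\<Delta> a|"
        using incons[of "?\<Delta> a"] by auto
      then have "|?\<Delta> a| <o \<kappa>"
        by (rule iffD1[OF not_ordLeq_iff_ordLess[OF card_of_Well_order card_order_on_well_order_on[OF assms(9)]]])
      then show "|?\<Delta> a| \<le>o ?t +c card_pred \<kappa>"
        using ordLess_imp_ordLeq_card_pred pred ordLeq_transitive by blast
    qed (use b in auto)
    ultimately show ?thesis
      using card_of_mono1 ordLeq_transitive by blast
  qed
  then show ?thesis
    unfolding NT_def using b by (intro card_Sup_ordLeq) auto
qed

end
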